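(* Let $u_{x,y}$ be a quasi-definite generalized kernel with second kind functions $C_1=(C_{1,0},C_{1,1},\dots)^\top$ and $C_2=(C_{2,0},C_{2,1},\dots)^\top$. For $z$ such that $|z|>\sup\{|y|:y\in\operatorname{supp}_y(u)\}$, $$C_1(z)=HS_2^{-\top}\chi^*(z),$$ while for $z$ such that $|z|>\sup\{|x|:x\in\operatorname{supp}_x(u)\}$, $$C_2(z)=HS_1^{-\top}\chi^*(z).$$
   Context: A generalized kernel $u_{x,y}$ is a distribution in Schwartz's space $\mathcal O_c'(\mathbb{R}^2)$; $\langle f(x),g(y)\rangle_u=u(f(x)g(y))$ whenever this pairing is defined; $\operatorname{supp}_x(u)$, $\operatorname{supp}_y(u)$ are the supports in the variables $x$ and $y$ (closures of the projections of the support). The Gram matrix is $G_{k,l}=\langle x^k,y^l\rangle_u$, $k,l\ge0$; $u$ is quasi-definite if all leading principal minors of $G$ are nonzero, and then uniquely $G=S_1^{-1}HS_2^{-\top}$ with $S_1,S_2$ lower unitriangular and $H=\operatorname{diag}(H_0,H_1,\dots)$. With $\chi(x)=(1,x,x^2,\dots)^\top$ and $\chi^*(z)=(z^{-1},z^{-2},z^{-3},\dots)^\top$, the biorthogonal polynomials are the entries of $P_1=S_1\chi$, $P_2=S_2\chi$. The second kind functions are $$C_{1,n}(z)=\Big\langle P_{1,n}(x),\frac1{z-y}\Big\rangle_u,\ z\notin\operatorname{supp}_y(u),\qquad C_{2,n}(z)=\Big\langle\frac1{z-x},P_{2,n}(y)\Big\rangle_u,\ z\notin\operatorname{supp}_x(u).$$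 Products of semi-infinite upper triangular matrices with $\chi^*(z)$ are entrywise convergent series. *)

theory Defs
  imports "HOL-Analysis.Analysis" "Jordan_Normal_Form.Determinant"
begin

type_synonym plane_fun = "real \<times> real \<Rightarrow> complex"

text \<open>Iterated partial derivatives, taken along a list of coordinate directions; the list
  \<open>vs \<in> lists Basis\<close> plays the role of a multi-index of order \<open>length vs\<close>.\<close>

primrec partials :: "(real \<times> real) list \<Rightarrow> plane_fun \<Rightarrow> plane_fun" where
  "partials [] f = f"
| "partials (v # vs) f = (\<lambda>p. frechet_derivative (partials vs f) (at p) v)"

definition smooth :: "plane_fun \<Rightarrow> bool" where
  "smooth f \<longleftrightarrow> (\<forall>vs\<in>lists Basis. \<forall>p. partials vs f differentiable (at p))"

definition fun_support :: "plane_fun \<Rightarrow> (real \<times> real) set" where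
  "fun_support f = closure {p. f p \<noteq> 0}"

definition test_functions :: "plane_fun set" where
  "test_functions = {f. smooth f \<and> compact (fun_support f)}"

text \<open>Schwartz's space \<open>\<O>\<^sub>c\<close> of very slowly increasing smooth functions is the union over \<open>k\<close>
  of the spaces \<open>slow_space k\<close>, in which all derivatives are bounded by a multiple of the same
  weight \<open>(1 + |p|\<^sup>2)\<^sup>k\<close>. It carries the inductive limit topology, so that a linear form on it is
  continuous iff its restriction to each \<open>slow_space k\<close> is continuous for the seminorms
  \<open>slow_seminorm k vs\<close>. Its dual is \<open>\<O>\<^sub>c'\<close>, the space of rapidly decreasing distributions.
  Only the values of a form on \<open>slow_funs\<close> are meaningful.\<close>

definition slow_quotient :: "nat \<Rightarrow> (real \<times> real) list \<Rightarrow> plane_fun \<Rightarrow> real \<times> real \<Rightarrow> real" where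
  "slow_quotient k vs f p = cmod (partials vs f p) / (1 + (norm p)\<^sup>2) ^ k"

definition slow_space :: "nat \<Rightarrow> plane_fun set" where
  "slow_space k = {f. smooth f \<and> (\<forall>vs\<in>lists Basis. bdd_above (range (slow_quotient k vs f)))}"

definition slow_seminorm :: "nat \<Rightarrow> (real \<times> real) list \<Rightarrow> plane_fun \<Rightarrow> real" where
  "slow_seminorm k vs f = (SUP p. slow_quotient k vs f p)"

definition slow_funs :: "plane_fun set" where
  "slow_funs = (\<Union>k. slow_space k)"

definition generalized_kernel :: "(plane_fun \<Rightarrow> complex) \<Rightarrow> bool" where
  "generalized_kernel u \<longleftrightarrow>
     (\<forall>f\<in>slow_funs. \<forall>g\<in>slow_funs. u (\<lambda>p. f p + g p) = u f + u g) \<and>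
     (\<forall>c. \<forall>f\<in>slow_funs. u (\<lambda>p. c * f p) = c * u f) \<and>
     (\<forall>k. \<exists>m C. \<forall>f\<in>slow_space k.
        cmod (u f) \<le> C * (\<Sum>vs | vs \<in> lists Basis \<and> length vs \<le> m. slow_seminorm k vs f))"

definition dist_support :: "(plane_fun \<Rightarrow> complex) \<Rightarrow> (real \<times> real) set" where
  "dist_support u = - \<Union>{U. open U \<and> (\<forall>f\<in>test_functions. fun_support f \<subseteq> U \<longrightarrow> u f = 0)}"

definition supp_x :: "(plane_fun \<Rightarrow> complex) \<Rightarrow> real set" where
  "supp_x u = closure (fst ` dist_support u)"

definition supp_y :: "(plane_fun \<Rightarrow> complex) \<Rightarrow> real set" where
  "supp_y u = closure (snd ` dist_support u)"

text \<open>The value \<open>\<langle>f(x), g(y)\<rangle>\<^sub>u\<close>. It is defined when \<open>f(x) g(y)\<close> agrees near the support of \<open>u\<close>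
  with some function in \<open>\<O>\<^sub>c\<close>; it does not depend on the choice of that function. This is needed for
  \<open>1 / (z - y)\<close> with \<open>z\<close> real outside the support, which is singular on the line \<open>y = z\<close>.\<close>

definition pairing :: "(plane_fun \<Rightarrow> complex) \<Rightarrow> (real \<Rightarrow> complex) \<Rightarrow> (real \<Rightarrow> complex) \<Rightarrow> complex" where
  "pairing u f g = (THE c. \<exists>\<phi>\<in>slow_funs. \<exists>U. open U \<and> dist_support u \<subseteq> U \<and>
     (\<forall>x y. (x, y) \<in> U \<longrightarrow> \<phi> (x, y) = f x * g y) \<and> c = u \<phi>)"

text \<open>Semi-infinite matrices. Entries of products are series; in the products formed below they
  have only finitely many nonzero terms, because of triangularity.\<close>

type_synonym smat = "nat \<Rightarrow> nat \<Rightarrow> complex"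

definition smat_id :: smat where
  "smat_id = (\<lambda>i j. if i = j then 1 else 0)"

definition smat_diag :: "(nat \<Rightarrow> complex) \<Rightarrow> smat" where
  "smat_diag h = (\<lambda>i j. if i = j then h i else 0)"

definition smat_mult :: "smat \<Rightarrow> smat \<Rightarrow> smat" where
  "smat_mult A B = (\<lambda>i j. \<Sum>k. A i k * B k j)"

definition smat_vec :: "smat \<Rightarrow> (nat \<Rightarrow> complex) \<Rightarrow> nat \<Rightarrow> complex" where
  "smat_vec A v = (\<lambda>i. \<Sum>k. A i k * v k)"

definition smat_transpose :: "smat \<Rightarrow> smat" where
  "smat_transpose A = (\<lambda>i j. A j i)"

definition lower_unitriangular :: "smat \<Rightarrow> bool" where
  "lower_unitriangular A \<longleftrightarrow> (\<forall>i. A i i = 1) \<and> (\<forall>i j. i < j \<longrightarrow> A i j = 0)"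

text \<open>For lower unitriangular \<open>A\<close> the inverse exists, is unique and is again lower unitriangular.\<close>

definition smat_inv :: "smat \<Rightarrow> smat" where
  "smat_inv A = (THE B. smat_mult A B = smat_id \<and> smat_mult B A = smat_id)"

definition gram :: "(plane_fun \<Rightarrow> complex) \<Rightarrow> smat" where
  "gram u = (\<lambda>k l. pairing u (\<lambda>x. complex_of_real x ^ k) (\<lambda>y. complex_of_real y ^ l))"

definition quasi_definite :: "(plane_fun \<Rightarrow> complex) \<Rightarrow> bool" where
  "quasi_definite u \<longleftrightarrow>
     (\<forall>n\<ge>1. Determinant.det (Matrix.mat n n (\<lambda>(i, j). gram u i j)) \<noteq> 0)"

definition gauss_borel :: "smat \<Rightarrow> smat \<Rightarrow> (nat \<Rightarrow> complex) \<Rightarrow> smat \<Rightarrow> bool" where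
  "gauss_borel G S1 h S2 \<longleftrightarrow> lower_unitriangular S1 \<and> lower_unitriangular S2 \<and>
     G = smat_mult (smat_mult (smat_inv S1) (smat_diag h)) (smat_transpose (smat_inv S2))"

definition chi :: "complex \<Rightarrow> nat \<Rightarrow> complex" where
  "chi x = (\<lambda>k. x ^ k)"

definition chi_star :: "complex \<Rightarrow> nat \<Rightarrow> complex" where
  "chi_star z = (\<lambda>k. 1 / z ^ Suc k)"

definition second_kind1 :: "(plane_fun \<Rightarrow> complex) \<Rightarrow> smat \<Rightarrow> nat \<Rightarrow> complex \<Rightarrow> complex" where
  "second_kind1 u S1 n z =
     pairing u (\<lambda>x. smat_vec S1 (chi (of_real x)) n) (\<lambda>y. 1 / (z - of_real y))"

definition second_kind2 :: "(plane_fun \<Rightarrow> complex) \<Rightarrow> smat \<Rightarrow> nat \<Rightarrow> complex \<Rightarrow> complex" where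
  "second_kind2 u S2 n z =
     pairing u (\<lambda>x. 1 / (z - of_real x)) (\<lambda>y. smat_vec S2 (chi (of_real y)) n)"

end

theory Submission
  imports Defs
begin

text \<open>Formally, \<open>1 / (z - y) = \<Sum>k. y\<^sup>k / z\<^sup>k\<^sup>+\<^sup>1\<close>, so the coefficient of \<open>z\<^sup>-\<^sup>k\<^sup>-\<^sup>1\<close> in \<open>C\<^sub>1\<^sub>,\<^sub>n(z)\<close> is the pairing of
  \<open>P\<^sub>1\<^sub>,\<^sub>n(x)\<close> with \<open>y\<^sup>k\<close>, which is the entry \<open>(n, k)\<close> of \<open>S\<^sub>1 G\<close>. Inserting the factorization of \<open>G\<close>
  turns this matrix into \<open>H\<close> times the inverse transpose of \<open>S\<^sub>2\<close> (\<open>gauss_borel_row\<close>). The statement on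
  \<open>C\<^sub>2\<close> is the same with the variables exchanged; both are instances of one expansion along a coordinate
  direction \<open>v\<close> (\<open>kernel_resolvent_expansion\<close>).

  The substance is the exchange of \<open>u\<close> with the infinite series, since \<open>u\<close> is only a continuous linear
  form and the series converges neither on the whole plane nor in the topology of the slowly increasing
  functions. A kernel annihilates every slowly increasing function that vanishes near its support
  (\<open>null_near_support\<close>), which allows \<open>y\<close> to be replaced by a bounded smooth function \<open>w(y)\<close> that agrees
  with \<open>y\<close> near the support and satisfies \<open>|w| \<le> r < |z|\<close>. Now \<open>1 / (z - w)\<close> is smooth everywhere, and each
  fixed derivative of the remainder \<open>(w / z)\<^sup>n / (z - w)\<close> is of order \<open>n\<^sup>m (r / |z|)\<^sup>n\<close>, where \<open>m\<close> is the
  order of the derivative (\<open>partials_power_bound\<close>). So the remainders tend to zero in the topology that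
  controls \<open>u\<close> (\<open>kernel_geometric_series\<close>).

  That a kernel does not see functions vanishing near its support requires smooth cutoff functions, all
  obtained from \<open>exp(-1/t)\<close>: they localize test functions (\<open>null_off_support\<close>) and truncate slowly
  increasing functions to test functions (\<open>null_near_support\<close>). The same fact shows that the pairing is
  well defined (\<open>pairing_eq\<close>).\<close>

section \<open>Calculus of iterated partial derivatives\<close>

(* Points of the plane are kept whole: splitting quantified pairs would hide the rules about them. *)
declare split_paired_All [simp del] split_paired_Ex [simp del]

lemma partials_append: "partials (vs @ ws) f = partials vs (partials ws f)"
  by (induction vs) auto

(* A single derivative is written partials [v] f; unfolding it would expose frechet_derivative. *)
declare partials.simps(2) [simp del]

text \<open>In a list of directions the first entry is the outermost derivative. Splitting off the last,
  innermost one instead makes smoothness a coinductive property, which is what the induction on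
  the order of differentiation below needs.\<close>

lemma smooth_altdef:
  "smooth f \<longleftrightarrow> (\<forall>p. f differentiable (at p)) \<and> (\<forall>v\<in>Basis. smooth (partials [v] f))"
proof
  assume f: "smooth f"
  have "f differentiable (at p)" for p
    using f unfolding smooth_def by (metis lists.Nil partials.simps(1))
  moreover have "smooth (partials [v] f)" if "v \<in> Basis" for v
    unfolding smooth_def
  proof (intro ballI allI)
    fix vs :: "(real \<times> real) list" and p assume "vs \<in> lists Basis"
    with that have "vs @ [v] \<in> lists Basis" by simp
    with f show "partials vs (partials [v] f) differentiable (at p)"
      unfolding smooth_def partials_append[symmetric] by blast
  qed
  ultimately show "(\<forall>p. f differentiable (at p)) \<and> (\<forall>v\<in>Basis. smooth (partials [v] f))"
    by blast
next
  assume f: "(\<forall>p. f differentiable (at p)) \<and> (\<forall>v\<in>Basis. smooth (partials [v] f))"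
  show "smooth f"
    unfolding smooth_def
  proof (intro ballI allI)
    fix vs :: "(real \<times> real) list" and p assume "vs \<in> lists Basis"
    then show "partials vs f differentiable (at p)"
    proof (cases vs rule: rev_cases)
      case Nil
      then show ?thesis using f by simp
    next
      case (snoc ws v)
      with f \<open>vs \<in> lists Basis\<close> show ?thesis
        unfolding smooth_def snoc partials_append by simp
    qed
  qed
qed

lemma smooth_differentiable: "smooth f \<Longrightarrow> f differentiable (at p)"
  using smooth_altdef by blast

lemma smooth_partial: "smooth f \<Longrightarrow> v \<in> Basis \<Longrightarrow> smooth (partials [v] f)"
  using smooth_altdef by blast

lemma smooth_partials: "smooth f \<Longrightarrow> vs \<in> lists Basis \<Longrightarrow> smooth (partials vs f)"
proof (induction vs)
  case (Cons v vs)
  then show ?case using smooth_partial[of "partials vs f" v] by (simp add: partials.simps(2))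
qed auto

text \<open>Products, reciprocals and compositions are treated by induction on the order: by the product,
  quotient and chain rules, a first derivative of such a function is built from the given functions,
  their first derivatives and functions of the same kind, of which only one order less is needed.\<close>

primrec smooth_upto :: "nat \<Rightarrow> plane_fun \<Rightarrow> bool" where
  "smooth_upto 0 f \<longleftrightarrow> (\<forall>p. f differentiable (at p))"
| "smooth_upto (Suc n) f \<longleftrightarrow>
     (\<forall>p. f differentiable (at p)) \<and> (\<forall>v\<in>Basis. smooth_upto n (partials [v] f))"

lemma smooth_upto_Suc_D: "smooth_upto (Suc n) f \<Longrightarrow> smooth_upto n f"
  by (induction n arbitrary: f) auto

lemma smooth_upto_iff:
  "smooth_upto n f \<longleftrightarrow> (\<forall>vs\<in>lists Basis. length vs \<le> n \<longrightarrow> (\<forall>p. partials vs f differentiable (at p)))"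
proof (induction n arbitrary: f)
  case 0
  show ?case by auto
next
  case (Suc n)
  show ?case (is "?L \<longleftrightarrow> ?R")
  proof
    assume L: ?L
    show ?R
    proof (intro ballI impI allI)
      fix vs :: "(real \<times> real) list" and p
      assume "vs \<in> lists Basis" "length vs \<le> Suc n"
      with L Suc show "partials vs f differentiable (at p)"
        by (cases vs rule: rev_cases) (auto simp: partials_append)
    qed
  next
    assume R: ?R
    have "f differentiable (at p)" for p
      using R[rule_format, of "[]"] by simp
    moreover have "smooth_upto n (partials [v] f)" if "v \<in> Basis" for v
      unfolding Suc partials_append[symmetric] using R that by simp
    ultimately show ?L by simp
  qed
qed

lemma smooth_iff_upto: "smooth f \<longleftrightarrow> (\<forall>n. smooth_upto n f)"
  unfolding smooth_def smooth_upto_iff by blast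

lemma partials_1:
  assumes "(f has_derivative f') (at p)"
  shows "partials [v] f p = f' v"
  using frechet_derivative_at[OF assms] by (simp add: partials.simps(2))

lemma has_derivative_partials:
  assumes "f differentiable (at p)"
  shows "(f has_derivative (\<lambda>v. partials [v] f p)) (at p)"
  using frechet_derivative_works[of f "at p"] assms by (simp add: partials.simps(2))

lemma partials_const: "vs \<noteq> [] \<Longrightarrow> partials vs (\<lambda>p. c) = (\<lambda>p. 0)"
proof (induction vs rule: rev_induct)
  case (snoc v vs)
  have *: "partials [v] (\<lambda>p. c) = (\<lambda>p. 0)" for c :: complex
    by (rule ext, rule partials_1, rule has_derivative_const)
  have "partials ws (\<lambda>p. 0) = (\<lambda>p. 0)" for ws
    by (induction ws) (simp_all add: partials.simps(2))
  with * show ?case by (simp add: partials_append)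
qed simp

lemma partial_add:
  assumes "f differentiable (at p)" "g differentiable (at p)"
  shows "partials [v] (\<lambda>p. f p + g p) p = partials [v] f p + partials [v] g p"
  by (rule partials_1, rule has_derivative_add)
     (rule assms[THEN has_derivative_partials])+

lemma partial_mult:
  assumes "f differentiable (at p)" "g differentiable (at p)"
  shows "partials [v] (\<lambda>p. f p * g p) p = f p * partials [v] g p + partials [v] f p * g p"
  by (rule partials_1, rule has_derivative_mult)
     (rule assms[THEN has_derivative_partials])+

lemma partial_inverse:
  assumes "f differentiable (at p)" "f p \<noteq> 0"
  shows "partials [v] (\<lambda>p. inverse (f p)) p = - (inverse (f p) * partials [v] f p * inverse (f p))"
  by (rule partials_1, rule Deriv.has_derivative_inverse[where f=f and x=p, OF assms(2)])
     (rule has_derivative_partials[OF assms(1)])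

lemma smooth_const [simp, intro]: "smooth (\<lambda>p. c)"
  unfolding smooth_def
proof (intro ballI allI)
  fix vs :: "(real \<times> real) list" and p
  show "partials vs (\<lambda>p. c) differentiable (at p)"
    by (cases "vs = []") (simp_all add: partials_const)
qed

lemma smooth_upto_add:
  "smooth_upto n f \<Longrightarrow> smooth_upto n g \<Longrightarrow> smooth_upto n (\<lambda>p. f p + g p)"
proof (induction n arbitrary: f g)
  case (Suc n)
  then have "partials [v] (\<lambda>p. f p + g p) = (\<lambda>p. partials [v] f p + partials [v] g p)" for v
    by (intro ext partial_add) auto
  with Suc show ?case by (auto intro: differentiable_add)
qed (auto intro: differentiable_add)

lemma smooth_upto_mult:
  "smooth_upto n f \<Longrightarrow> smooth_upto n g \<Longrightarrow> smooth_upto n (\<lambda>p. f p * g p)"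
proof (induction n arbitrary: f g)
  case (Suc n)
  then have "partials [v] (\<lambda>p. f p * g p) = (\<lambda>p. f p * partials [v] g p + partials [v] f p * g p)" for v
    by (intro ext partial_mult) auto
  moreover have "smooth_upto n f" "smooth_upto n g"
    using Suc.prems by (blast dest: smooth_upto_Suc_D)+
  moreover have "(\<lambda>p. f p * g p) differentiable (at p)" for p
    using Suc.prems by (intro differentiable_mult) auto
  ultimately show ?case using Suc by (simp add: smooth_upto_add)
qed (auto intro: differentiable_mult)

lemma smooth_add [intro]: "smooth f \<Longrightarrow> smooth g \<Longrightarrow> smooth (\<lambda>p. f p + g p)"
  by (simp add: smooth_iff_upto smooth_upto_add)

lemma smooth_mult [intro]: "smooth f \<Longrightarrow> smooth g \<Longrightarrow> smooth (\<lambda>p. f p * g p)"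
  by (simp add: smooth_iff_upto smooth_upto_mult)

lemma smooth_diff [intro]: "smooth f \<Longrightarrow> smooth g \<Longrightarrow> smooth (\<lambda>p. f p - g p)"
  using smooth_add[of f "\<lambda>p. (-1) * g p"] smooth_mult[of "\<lambda>p. -1" g] by simp

lemma smooth_power [intro]: "smooth f \<Longrightarrow> smooth (\<lambda>p. f p ^ n)"
  by (induction n) auto

lemma smooth_inverse:
  assumes f: "smooth f" and nz: "\<And>p. f p \<noteq> 0"
  shows "smooth (\<lambda>p. inverse (f p))"
proof -
  have *: "smooth_upto n (\<lambda>p. inverse (f p))" for n
  proof (induction n)
    case 0
    show ?case using f nz by (auto intro: differentiable_inverse smooth_differentiable)
  next
    case (Suc n)
    have "partials [v] (\<lambda>p. inverse (f p)) =
       (\<lambda>p. (-1) * (inverse (f p) * partials [v] f p * inverse (f p)))" for v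
      using f nz by (auto simp: partial_inverse smooth_differentiable)
    moreover have "smooth_upto n (\<lambda>p. -1)" "v \<in> Basis \<Longrightarrow> smooth_upto n (partials [v] f)" for v
      using smooth_const smooth_partial[OF f] unfolding smooth_iff_upto by blast+
    ultimately have "smooth_upto n (partials [v] (\<lambda>p. inverse (f p)))" if "v \<in> Basis" for v
      using Suc that by (simp only: smooth_upto_mult)
    moreover have "(\<lambda>p. inverse (f p)) differentiable (at p)" for p
      using differentiable_inverse[OF smooth_differentiable[OF f] nz] .
    ultimately show ?case by simp
  qed
  then show ?thesis unfolding smooth_iff_upto ..
qed

text \<open>The outer function is one member of a family closed under differentiation. A family is needed
  because the derivatives of a flat function are different functions of the same shape; its index
  records which member arises.\<close>

lemma smooth_compose:
  fixes F :: "'i \<Rightarrow> real \<Rightarrow> real" and g :: "real \<times> real \<Rightarrow> real"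
  assumes F: "\<And>i t. (F i has_real_derivative F (next i) t) (at t)"
    and g: "smooth (\<lambda>p. complex_of_real (g p))"
  shows "smooth (\<lambda>p. complex_of_real (F i (g p)))"
proof -
  define G where "G = (\<lambda>p. complex_of_real (g p))"
  have dG: "(G has_derivative (\<lambda>v. partials [v] G p)) (at p)" for p
    using g unfolding G_def by (intro has_derivative_partials smooth_differentiable)
  have dg: "(g has_derivative (\<lambda>v. Re (partials [v] G p))) (at p)" for p
    using bounded_linear.has_derivative[OF bounded_linear_Re dG[of p]] by (simp add: G_def)
  \<comment> \<open>differentiation commutes with taking the real part, so the derivatives of \<open>G\<close> are real as well\<close>
  have im: "complex_of_real (Re (partials [v] G p)) = partials [v] G p" for v p
  proof -
    have "((\<lambda>p. complex_of_real (g p)) has_derivative (\<lambda>v. of_real (Re (partials [v] G p)))) (at p)"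
      using bounded_linear.has_derivative[OF bounded_linear_of_real dg[of p]] .
    from partials_1[OF this, of v] show ?thesis by (simp add: G_def)
  qed
  have D: "((\<lambda>p. complex_of_real (F i (g p))) has_derivative
          (\<lambda>v. complex_of_real (F (next i) (g p)) * partials [v] G p)) (at p)" for i p
  proof -
    have "((\<lambda>p. F i (g p)) has_derivative (\<lambda>v. Re (partials [v] G p) * F (next i) (g p))) (at p)"
      using has_derivative_compose[OF dg[of p]  F[of i "g p", unfolded has_field_derivative_def]]
      by (simp add: mult.commute)
    from bounded_linear.has_derivative[OF bounded_linear_of_real[where 'a=complex] this]
    show ?thesis unfolding of_real_mult im by (simp only: mult.commute)
  qed
  have "smooth_upto n (\<lambda>p. complex_of_real (F i (g p)))" for n
  proof (induction n arbitrary: i)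
    case 0
    show ?case using differentiableI[OF D] by simp
  next
    case (Suc n)
    have "partials [v] (\<lambda>p. complex_of_real (F i (g p))) =
       (\<lambda>p. complex_of_real (F (next i) (g p)) * partials [v] G p)" for v
      by (intro ext partials_1 D)
    moreover have "smooth_upto n (partials [v] G)" if "v \<in> Basis" for v
      using smooth_partial[of G v] g that unfolding G_def smooth_iff_upto by blast
    moreover have "(\<lambda>p. complex_of_real (F i (g p))) differentiable (at p)" for p
      using D by (rule differentiableI)
    ultimately show ?case using Suc smooth_upto_mult by simp
  qed
  then show ?thesis unfolding smooth_iff_upto ..
qed

lemma has_derivative_inner_complex:
  "((\<lambda>p::real \<times> real. complex_of_real (inner p v)) has_derivative (\<lambda>w. complex_of_real (inner w v))) (at p)"
  by (intro bounded_linear_imp_has_derivative bounded_linear_compose[OF bounded_linear_of_real bounded_linear_inner_left])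

lemma partial_inner:
  "partials [w] (\<lambda>p. complex_of_real (inner p v)) = (\<lambda>p. complex_of_real (inner w v))"
  by (rule ext, rule partials_1, rule has_derivative_inner_complex)

lemma smooth_inner [intro]: "smooth (\<lambda>p. complex_of_real (inner p v))"
  unfolding smooth_altdef[of "\<lambda>p. complex_of_real (inner p v)"] partial_inner
  using differentiableI[OF has_derivative_inner_complex] by blast

lemma partials_add:
  assumes "smooth f" "smooth g" "vs \<in> lists Basis"
  shows "partials vs (\<lambda>p. f p + g p) = (\<lambda>p. partials vs f p + partials vs g p)"
  using assms(3)
proof (induction vs)
  case (Cons v vs)
  then have "partials [v] (\<lambda>p. partials vs f p + partials vs g p) = 
      (\<lambda>p. partials [v] (partials vs f) p + partials [v] (partials vs g) p)"
    using assms by (intro ext partial_add smooth_differentiable smooth_partials) auto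
  with Cons show ?case by (simp add: partials.simps(2))
qed simp

lemma partials_cmult:
  assumes "smooth f" "vs \<in> lists Basis"
  shows "partials vs (\<lambda>p. c * f p) = (\<lambda>p. c * partials vs f p)"
  using assms(2)
proof (induction vs)
  case (Cons v vs)
  have "partials [v] (\<lambda>p. c * partials vs f p) = 
      (\<lambda>p. c * partials [v] (partials vs f) p + partials [v] (\<lambda>p. c) p * partials vs f p)"
    using Cons assms by (intro ext partial_mult smooth_differentiable smooth_partials) auto
  with Cons show ?case using partials_const[of "[v]" c] by (simp add: partials.simps(2))
qed simp

text \<open>Differentiating is local. It is enough that one of the two functions is smooth: the other one then
  inherits the derivatives on \<open>U\<close>.\<close>

lemma partials_local:
  assumes "open U" "\<And>p. p \<in> U \<Longrightarrow> f p = g p" "smooth f" "vs \<in> lists Basis" "p \<in> U"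
  shows "partials vs f p = partials vs g p"
  using assms(4,5)
proof (induction vs arbitrary: p)
  case (Cons v vs)
  have "partials vs f differentiable (at p)"
    using Cons assms(3) by (intro smooth_differentiable smooth_partials) auto
  then have "(partials vs f has_derivative (\<lambda>v. partials [v] (partials vs f) p)) (at p)"
    by (rule has_derivative_partials)
  then have "(partials vs g has_derivative (\<lambda>v. partials [v] (partials vs f) p)) (at p)"
    using has_derivative_transform_within_open assms(1) Cons by fastforce
  from partials_1[OF this, of v] show ?case by (simp add: partials.simps(2))
qed (simp add: assms)

lemma partials_affine:
  assumes "smooth f" "vs \<in> lists Basis"
  shows "partials vs (\<lambda>p. f (c *\<^sub>R p + a)) = (\<lambda>p. of_real c ^ length vs * partials vs f (c *\<^sub>R p + a))"
  using assms(2)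
proof (induction vs)
  case (Cons v vs)
  define h where "h = partials vs f"
  have h: "smooth h" using Cons assms unfolding h_def by (intro smooth_partials) auto
  have "((\<lambda>p. of_real c ^ length vs * h (c *\<^sub>R p + a)) has_derivative
      (\<lambda>w. of_real c ^ length vs * partials [c *\<^sub>R w] h (c *\<^sub>R p + a))) (at p)" for p
  proof -
    have "((\<lambda>p. c *\<^sub>R p + a) has_derivative (\<lambda>w. c *\<^sub>R w)) (at p)"
      by (auto intro!: derivative_eq_intros)
    from has_derivative_compose[OF this has_derivative_partials[OF smooth_differentiable[OF h]]]
    show ?thesis by (rule has_derivative_mult_right)
  qed
  from partials_1[OF this] 
  have "partials [v] (\<lambda>p. of_real c ^ length vs * h (c *\<^sub>R p + a)) =
     (\<lambda>p. of_real c ^ length vs * partials [c *\<^sub>R v] h (c *\<^sub>R p + a))"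
    by (rule ext)
  moreover have "partials [c *\<^sub>R v] h q = of_real c * partials [v] h q" for q
    using linear_cmul[OF has_derivative_linear[OF has_derivative_partials[OF smooth_differentiable[OF h, of q]]], of c v]
    by (simp add: scaleR_conv_of_real)
  ultimately have "partials [v] (\<lambda>p. of_real c ^ length vs * h (c *\<^sub>R p + a)) =
     (\<lambda>p. of_real c ^ Suc (length vs) * partials [v] h (c *\<^sub>R p + a))"
    by (simp add: mult_ac)
  then show ?case using Cons by (simp add: h_def partials.simps(2))
qed simp

lemma smooth_affine:
  assumes "smooth f"
  shows "smooth (\<lambda>p. f (c *\<^sub>R p + a))"
  unfolding smooth_def
proof (intro ballI allI)
  fix vs :: "(real \<times> real) list" and p assume vs: "vs \<in> lists Basis"
  have "(\<lambda>p. c *\<^sub>R p + a) differentiable (at p)"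
    by (intro derivative_intros)
  with smooth_differentiable[OF smooth_partials[OF assms vs]]
  have "(\<lambda>p. partials vs f (c *\<^sub>R p + a)) differentiable (at p)"
    by (rule differentiable_compose)
  then show "partials vs (\<lambda>p. f (c *\<^sub>R p + a)) differentiable (at p)"
    unfolding partials_affine[OF assms vs] by (intro differentiable_mult) auto
qed

section \<open>Slowly increasing functions\<close>

definition multi_indices :: "nat \<Rightarrow> (real \<times> real) list set" where
  "multi_indices n = {vs. vs \<in> lists Basis \<and> length vs \<le> n}"

lemma finite_multi_indices [simp, intro]: "finite (multi_indices n)"
  unfolding multi_indices_def in_lists_conv_set subset_eq[symmetric]
  using finite_lists_length_le[of "Basis :: (real \<times> real) set" n] by (simp add: subset_eq)

text \<open>A pointwise measure of all derivatives up to order \<open>n\<close>, which turns the Leibniz rule into a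
  single inequality without multinomial coefficients.\<close>

definition jet :: "nat \<Rightarrow> plane_fun \<Rightarrow> real \<times> real \<Rightarrow> real" where
  "jet n f p = (\<Sum>vs\<in>multi_indices n. cmod (partials vs f p))"

lemma jet_nonneg: "0 \<le> jet n f p"
  unfolding jet_def by (rule sum_nonneg) simp

lemma jet_le_Suc: "jet n f p \<le> jet (Suc n) f p"
  unfolding jet_def by (rule sum_mono2[OF finite_multi_indices]) (auto simp: multi_indices_def)

lemma jet_partial_le:
  assumes "v \<in> Basis"
  shows "jet n (partials [v] f) p \<le> jet (Suc n) f p"
proof -
  have "jet n (partials [v] f) p = (\<Sum>vs\<in>(\<lambda>vs. vs @ [v]) ` multi_indices n. cmod (partials vs f p))"
    unfolding jet_def by (subst sum.reindex) (auto simp: inj_on_def partials_append)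
  also have "\<dots> \<le> jet (Suc n) f p"
    unfolding jet_def by (rule sum_mono2[OF finite_multi_indices]) (use assms in \<open>auto simp: multi_indices_def\<close>)
  finally show ?thesis .
qed

text \<open>Taking off the innermost derivative splits a product into two products, each with one derivative
  less; this doubling is the factor \<open>2 ^ length vs\<close>.\<close>

lemma partials_mult_bound:
  assumes "smooth f" "smooth g" "vs \<in> lists Basis"
  shows "cmod (partials vs (\<lambda>p. f p * g p) p)
           \<le> 2 ^ length vs * (jet (length vs) f p * jet (length vs) g p)"
  using assms
proof (induction vs arbitrary: f g rule: rev_induct)
  case Nil
  show ?case
    by (simp add: norm_mult jet_def multi_indices_def Collect_conj_eq2 cong: conj_cong)
next
  case (snoc v vs)
  let ?n = "length vs"
  let ?J = "jet (Suc ?n) f p * jet (Suc ?n) g p"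
  have v: "v \<in> Basis" and vs: "vs \<in> lists Basis" using snoc.prems by auto
  have sm: "smooth (partials [v] f)" "smooth (partials [v] g)"
    using snoc.prems v by (auto intro: smooth_partial)
  have "partials [v] (\<lambda>p. f p * g p) = (\<lambda>p. f p * partials [v] g p + partials [v] f p * g p)"
    using snoc.prems by (intro ext partial_mult smooth_differentiable)
  then have "partials (vs @ [v]) (\<lambda>p. f p * g p) p =
      partials vs (\<lambda>p. f p * partials [v] g p) p + partials vs (\<lambda>p. partials [v] f p * g p) p"
    using snoc.prems sm vs by (simp add: partials_append partials_add smooth_mult)
  moreover have "cmod (partials vs (\<lambda>p. f p * partials [v] g p) p) \<le> 2 ^ ?n * ?J"
    using snoc.IH[OF snoc.prems(1) sm(2) vs]
    by (rule order_trans) (intro mult_left_mono mult_mono jet_le_Suc jet_partial_le v jet_nonneg, simp)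
  moreover have "cmod (partials vs (\<lambda>p. partials [v] f p * g p) p) \<le> 2 ^ ?n * ?J"
    using snoc.IH[OF sm(1) snoc.prems(2) vs]
    by (rule order_trans) (intro mult_left_mono mult_mono jet_le_Suc jet_partial_le v jet_nonneg, simp)
  ultimately show ?case
    by (simp add: norm_triangle_le)
qed

text \<open>The weight is positive, so boundedness of the quotients means domination by the weight. For \<open>k = 0\<close>
  these are the smooth functions with all derivatives bounded.\<close>

lemma slow_space_iff:
  "f \<in> slow_space k \<longleftrightarrow>
     smooth f \<and> (\<forall>vs\<in>lists Basis. \<exists>C. \<forall>p. cmod (partials vs f p) \<le> C * (1 + (norm p)\<^sup>2) ^ k)"
proof -
  have pos: "0 < (1 + (norm p)\<^sup>2) ^ k" for p :: "real \<times> real"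
    by (intro zero_less_power add_pos_nonneg) auto
  show ?thesis
    unfolding slow_space_def slow_quotient_def bdd_above_def
    by (simp add: pos divide_le_eq)
qed

lemma slow_space_smooth: "f \<in> slow_space k \<Longrightarrow> smooth f"
  by (simp add: slow_space_iff)

lemma slow_spaceE:
  assumes "f \<in> slow_space k" "vs \<in> lists Basis"
  obtains C where "C \<ge> 0" "\<And>p. cmod (partials vs f p) \<le> C * (1 + (norm p)\<^sup>2) ^ k"
proof -
  obtain C where C: "cmod (partials vs f p) \<le> C * (1 + (norm p)\<^sup>2) ^ k" for p
    using assms unfolding slow_space_iff by blast
  have "0 \<le> C" using order_trans[OF norm_ge_zero C[of 0]] by simp
  with C that show ?thesis by blast
qed

lemma slow_space_partial:
  assumes "f \<in> slow_space k" "v \<in> Basis"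
  shows "partials [v] f \<in> slow_space k"
  unfolding slow_space_iff
proof (intro conjI ballI)
  show "smooth (partials [v] f)" using assms smooth_partial slow_space_smooth by blast
  fix vs :: "(real \<times> real) list" assume "vs \<in> lists Basis"
  with assms(2) have "vs @ [v] \<in> lists Basis" by simp
  from slow_spaceE[OF assms(1) this]
  show "\<exists>C. \<forall>p. cmod (partials vs (partials [v] f) p) \<le> C * (1 + (norm p)\<^sup>2) ^ k"
    unfolding partials_append by metis
qed

lemma slow_space_jet:
  assumes "f \<in> slow_space k"
  obtains C where "C \<ge> 0" "\<And>p. jet n f p \<le> C * (1 + (norm p)\<^sup>2) ^ k"
proof -
  have "\<exists>C. \<forall>vs\<in>multi_indices n. 0 \<le> C vs \<and>
      (\<forall>p. cmod (partials vs f p) \<le> C vs * (1 + (norm p)\<^sup>2) ^ k)"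
    by (rule bchoice) (metis (lifting) slow_spaceE[OF assms] multi_indices_def mem_Collect_eq)
  then obtain C where C: "\<And>vs. vs \<in> multi_indices n \<Longrightarrow> 0 \<le> C vs"
    "\<And>vs p. vs \<in> multi_indices n \<Longrightarrow> cmod (partials vs f p) \<le> C vs * (1 + (norm p)\<^sup>2) ^ k"
    by blast
  show ?thesis
  proof (rule that)
    show "0 \<le> sum C (multi_indices n)" using C(1) by (rule sum_nonneg)
    show "jet n f p \<le> sum C (multi_indices n) * (1 + (norm p)\<^sup>2) ^ k" for p
      unfolding jet_def sum_distrib_right using C(2) by (rule sum_mono)
  qed
qed

lemma slow_space_mult:
  assumes "f \<in> slow_space j" "g \<in> slow_space k"
  shows "(\<lambda>p. f p * g p) \<in> slow_space (j + k)"
  unfolding slow_space_iff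
proof (intro conjI ballI)
  show "smooth (\<lambda>p. f p * g p)" using assms slow_space_smooth by blast
  fix vs :: "(real \<times> real) list" assume vs: "vs \<in> lists Basis"
  let ?n = "length vs"
  obtain C where C: "C \<ge> 0" "\<And>p. jet ?n f p \<le> C * (1 + (norm p)\<^sup>2) ^ j"
    using slow_space_jet[OF assms(1)] by blast
  obtain D where D: "D \<ge> 0" "\<And>p. jet ?n g p \<le> D * (1 + (norm p)\<^sup>2) ^ k"
    using slow_space_jet[OF assms(2)] by blast
  have "cmod (partials vs (\<lambda>p. f p * g p) p) \<le> (2 ^ ?n * (C * D)) * (1 + (norm p)\<^sup>2) ^ (j + k)" for p
  proof -
    have "cmod (partials vs (\<lambda>p. f p * g p) p) \<le> 2 ^ ?n * (jet ?n f p * jet ?n g p)"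
      using assms vs by (intro partials_mult_bound slow_space_smooth)
    also have "\<dots> \<le> 2 ^ ?n * ((C * (1 + (norm p)\<^sup>2) ^ j) * (D * (1 + (norm p)\<^sup>2) ^ k))"
      using C D by (intro mult_left_mono mult_mono jet_nonneg) auto
    finally show ?thesis by (simp add: power_add mult_ac)
  qed
  then show "\<exists>C. \<forall>p. cmod (partials vs (\<lambda>p. f p * g p) p) \<le> C * (1 + (norm p)\<^sup>2) ^ (j + k)"
    by blast
qed

lemma slow_space_const: "(\<lambda>p. c) \<in> slow_space 0"
  unfolding slow_space_iff
proof (intro conjI ballI)
  fix vs :: "(real \<times> real) list"
  show "\<exists>C. \<forall>p. cmod (partials vs (\<lambda>p. c) p) \<le> C * (1 + (norm p)\<^sup>2) ^ 0"
    by (cases "vs = []") (auto simp: partials_const)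
qed auto

lemma slow_space_cmult: "f \<in> slow_space k \<Longrightarrow> (\<lambda>p. c * f p) \<in> slow_space k"
  using slow_space_mult[OF slow_space_const[of c], of f k] by simp

lemma slow_space_add:
  assumes "f \<in> slow_space k" "g \<in> slow_space k"
  shows "(\<lambda>p. f p + g p) \<in> slow_space k"
  unfolding slow_space_iff
proof (intro conjI ballI)
  show "smooth (\<lambda>p. f p + g p)" using assms slow_space_smooth by blast
  fix vs :: "(real \<times> real) list" assume vs: "vs \<in> lists Basis"
  obtain C where C: "\<And>p. cmod (partials vs f p) \<le> C * (1 + (norm p)\<^sup>2) ^ k"
    using slow_spaceE[OF assms(1) vs] by blast
  obtain D where D: "\<And>p. cmod (partials vs g p) \<le> D * (1 + (norm p)\<^sup>2) ^ k"
    using slow_spaceE[OF assms(2) vs] by blast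
  have "cmod (partials vs (\<lambda>p. f p + g p) p) \<le> (C + D) * (1 + (norm p)\<^sup>2) ^ k" for p
    using assms[THEN slow_space_smooth] vs norm_triangle_ineq[of "partials vs f p" "partials vs g p"]
      C[of p] D[of p] by (simp add: partials_add algebra_simps)
  then show "\<exists>C. \<forall>p. cmod (partials vs (\<lambda>p. f p + g p) p) \<le> C * (1 + (norm p)\<^sup>2) ^ k"
    by blast
qed

lemma slow_space_mono:
  assumes "f \<in> slow_space j" "j \<le> k"
  shows "f \<in> slow_space k"
  unfolding slow_space_iff
proof (intro conjI ballI)
  show "smooth f" using assms slow_space_smooth by blast
  fix vs :: "(real \<times> real) list" assume vs: "vs \<in> lists Basis"
  obtain C where C: "0 \<le> C" "\<And>p. cmod (partials vs f p) \<le> C * (1 + (norm p)\<^sup>2) ^ j"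
    using slow_spaceE[OF assms(1) vs] by blast
  have "C * (1 + (norm p)\<^sup>2) ^ j \<le> C * (1 + (norm p)\<^sup>2) ^ k" for p :: "real \<times> real"
    using C(1) assms(2) by (intro mult_left_mono power_increasing) auto
  with C show "\<exists>C. \<forall>p. cmod (partials vs f p) \<le> C * (1 + (norm p)\<^sup>2) ^ k"
    by (meson order_trans)
qed

lemma slow_funs_const [intro]: "(\<lambda>p. c) \<in> slow_funs"
  using slow_space_const unfolding slow_funs_def by blast

lemma slow_funs_mult [intro]:
  "f \<in> slow_funs \<Longrightarrow> g \<in> slow_funs \<Longrightarrow> (\<lambda>p. f p * g p) \<in> slow_funs"
  using slow_space_mult unfolding slow_funs_def by blast

lemma slow_funs_add [intro]:
  assumes "f \<in> slow_funs" "g \<in> slow_funs"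
  shows "(\<lambda>p. f p + g p) \<in> slow_funs"
proof -
  obtain j k where "f \<in> slow_space j" "g \<in> slow_space k"
    using assms unfolding slow_funs_def by blast
  then have "f \<in> slow_space (max j k)" "g \<in> slow_space (max j k)"
    using slow_space_mono by (meson max.cobounded1 max.cobounded2)+
  then show ?thesis
    using slow_space_add unfolding slow_funs_def by blast
qed

lemma slow_funs_diff [intro]:
  "f \<in> slow_funs \<Longrightarrow> g \<in> slow_funs \<Longrightarrow> (\<lambda>p. f p - g p) \<in> slow_funs"
  using slow_funs_add[of f "\<lambda>p. (-1) * g p"] slow_funs_mult[of "\<lambda>p. -1" g] slow_funs_const by simp

lemma slow_funs_power [intro]: "f \<in> slow_funs \<Longrightarrow> (\<lambda>p. f p ^ n) \<in> slow_funs"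
  by (induction n) auto

lemma slow_funs_sum [intro]:
  "(\<And>i. i \<in> I \<Longrightarrow> f i \<in> slow_funs) \<Longrightarrow> (\<lambda>p. \<Sum>i\<in>I. f i p) \<in> slow_funs"
  by (induction I rule: infinite_finite_induct) auto

lemma slow_funs_inner [intro]: "(\<lambda>p. complex_of_real (inner p v)) \<in> slow_funs"
proof -
  have "(\<lambda>p. complex_of_real (inner p v)) \<in> slow_space 1"
    unfolding slow_space_iff
  proof (intro conjI ballI)
    fix vs :: "(real \<times> real) list" assume vs: "vs \<in> lists Basis"
    show "\<exists>C. \<forall>p. cmod (partials vs (\<lambda>p. complex_of_real (inner p v)) p) \<le> C * (1 + (norm p)\<^sup>2) ^ 1"
    proof (cases vs rule: rev_cases)
      case Nil
      have "\<bar>inner p v\<bar> \<le> norm v * (1 + (norm p)\<^sup>2)" for p :: "real \<times> real"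
      proof -
        have "norm p \<le> 1 + (norm p)\<^sup>2"
          using zero_le_power2[of "norm p - 1/2"] by (simp add: power2_eq_square algebra_simps)
        then have "norm v * norm p \<le> norm v * (1 + (norm p)\<^sup>2)"
          by (intro mult_left_mono) auto
        with Cauchy_Schwarz_ineq2[of p v] show ?thesis by (simp add: mult.commute)
      qed
      then show ?thesis unfolding Nil by (intro exI[of _ "norm v"] allI) simp
    next
      case (snoc ws w)
      obtain C where C: "C \<ge> 0" "\<And>p. cmod (partials ws (\<lambda>p. complex_of_real (inner w v)) p) \<le> C * (1 + (norm p)\<^sup>2) ^ 0"
        using slow_spaceE[OF slow_space_const] snoc vs by (metis append_in_lists_conv)
      have "C \<le> C * (1 + (norm p)\<^sup>2)" for p :: "real \<times> real"
        using C(1) by (simp add: algebra_simps)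
      with C show ?thesis unfolding snoc partials_append partial_inner
        by (metis mult.right_neutral order_trans power_0 power_one_right)
    qed
  qed auto
  then show ?thesis unfolding slow_funs_def by blast
qed

section \<open>Cutoff functions\<close>

text \<open>The functions \<open>P(1/t) exp(-1/t)\<close>, extended by zero to \<open>t \<le> 0\<close>, form a family closed under
  differentiation. They are the source of all cutoff functions.\<close>

definition flat :: "real poly \<Rightarrow> real \<Rightarrow> real" where
  "flat P t = (if 0 < t then poly P (inverse t) * exp (- inverse t) else 0)"

lemma poly_div_exp_tendsto_0: "((\<lambda>s. poly P s * exp (- s)) \<longlongrightarrow> (0::real)) at_top"
proof -
  have "((\<lambda>s. \<Sum>i\<le>degree P. coeff P i * (s ^ i / exp s)) \<longlongrightarrow> (\<Sum>i\<le>degree P. coeff P i * 0)) at_top"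
    by (intro tendsto_intros tendsto_power_div_exp_0)
  then show ?thesis
    by (simp add: poly_altdef exp_minus sum_distrib_right divide_inverse mult.assoc)
qed

lemma flat_tendsto_0: "(flat P \<longlongrightarrow> 0) (at 0)"
proof -
  have "((\<lambda>t. poly P (inverse t) * exp (- inverse t)) \<longlongrightarrow> 0) (at_right 0)"
    using filterlim_compose[OF poly_div_exp_tendsto_0 filterlim_inverse_at_top_right] .
  then have "(flat P \<longlongrightarrow> 0) (at_right 0)"
    by (rule Lim_transform_eventually)
       (use eventually_at_right_less[of "0::real"] in eventually_elim, simp add: flat_def)
  moreover have "(flat P \<longlongrightarrow> 0) (at_left 0)"
    by (rule Lim_transform_eventually[OF tendsto_const])
       (auto simp: flat_def eventually_at_filter)
  ultimately show ?thesis by (simp add: filterlim_split_at)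
qed

lemma DERIV_flat: "(flat P has_real_derivative flat ([:0, 0, 1:] * (P - pderiv P)) t) (at t)"
proof -
  let ?Q = "[:0, 0, 1:] * (P - pderiv P)"
  consider "t < 0" | "t = 0" | "0 < t" by linarith
  then show ?thesis
  proof cases
    case 1
    have "((\<lambda>t. 0) has_real_derivative flat ?Q t) (at t)" using 1 by (simp add: flat_def)
    then show ?thesis
      by (rule has_field_derivative_transform_within_open[where S="{..<0}"])
         (use 1 in \<open>auto simp: flat_def\<close>)
  next
    case 2
    \<comment> \<open>the difference quotient at the origin is again a flat function\<close>
    have eq: "flat ([:0, 1:] * P) = (\<lambda>s. (flat P s - flat P 0) / (s - 0))"
      by (rule ext) (simp add: flat_def divide_inverse)
    have "flat ?Q 0 = 0" by (simp add: flat_def)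
    with flat_tendsto_0[of "[:0, 1:] * P"] show ?thesis
      unfolding 2 has_field_derivative_iff eq by (simp only:)
  next
    case 3
    have d: "(inverse has_real_derivative - (inverse t * inverse t)) (at t)"
      using DERIV_inverse[of t] 3 by (simp add: power2_eq_square)
    have "((\<lambda>t. poly P (inverse t) * exp (- inverse t)) has_real_derivative flat ?Q t) (at t)"
      using DERIV_mult[OF DERIV_chain2[OF poly_DERIV[of P] d] DERIV_chain2[OF DERIV_exp DERIV_minus[OF d]]]
        3 by (simp add: flat_def algebra_simps)
    then show ?thesis
      by (rule has_field_derivative_transform_within_open[where S="{0<..}"])
         (use 3 in \<open>auto simp: flat_def\<close>)
  qed
qed

text \<open>The quotient \<open>F(b - t) / (F(b - t) + F(t - a))\<close> with \<open>F(t) = exp(-1/t)\<close> for \<open>t > 0\<close> falls from one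
  to zero on \<open>[a, b]\<close>; its denominator never vanishes since \<open>t < b\<close> or \<open>t > a\<close>. Its smoothness is
  expressed through compositions, the only form in which it is used, so that calculus on the plane
  suffices.\<close>

lemma smooth_step:
  fixes a b :: real
  assumes "a < b"
  obtains \<theta> :: "real \<Rightarrow> real" where
    "\<And>t. 0 \<le> \<theta> t" "\<And>t. \<theta> t \<le> 1" "\<And>t. t \<le> a \<Longrightarrow> \<theta> t = 1" "\<And>t. b \<le> t \<Longrightarrow> \<theta> t = 0"
    "\<And>g. smooth (\<lambda>p. complex_of_real (g p)) \<Longrightarrow> smooth (\<lambda>p. complex_of_real (\<theta> (g p)))"
proof -
  define F where "F = flat 1"
  define \<theta> where "\<theta> = (\<lambda>t. F (b - t) * inverse (F (b - t) + F (t - a)))"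
  have F: "0 \<le> F t" "0 < t \<Longrightarrow> 0 < F t" "t \<le> 0 \<Longrightarrow> F t = 0" for t
    by (auto simp: F_def flat_def)
  have pos: "0 < F (b - t) + F (t - a)" for t
    using F assms by (cases "t < b") (auto intro: add_pos_nonneg add_nonneg_pos)
  show ?thesis
  proof (rule that)
    show "0 \<le> \<theta> t" for t
      using F(1) less_imp_le[OF pos] by (simp add: \<theta>_def)
    show "\<theta> t \<le> 1" for t
      using F(1)[of "t - a"] pos[of t] by (simp add: \<theta>_def divide_inverse[symmetric])
    show "\<theta> t = 1" if "t \<le> a" for t
      using F(2)[of "b - t"] F(3)[of "t - a"] that assms by (simp add: \<theta>_def)
    show "\<theta> t = 0" if "b \<le> t" for t
      using F(3)[of "b - t"] that by (simp add: \<theta>_def)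
    fix g assume g: "smooth (\<lambda>p. complex_of_real (g p))"
    have "smooth (\<lambda>p. complex_of_real (F (h p)))" if "smooth (\<lambda>p. complex_of_real (h p))" for h
      unfolding F_def
      using that by (rule smooth_compose[where F=flat, OF DERIV_flat])
    moreover have "smooth (\<lambda>p. complex_of_real (b - g p))" "smooth (\<lambda>p. complex_of_real (g p - a))"
      unfolding of_real_diff by (intro smooth_diff g smooth_const)+
    ultimately have s: "smooth (\<lambda>p. complex_of_real (F (b - g p)))" "smooth (\<lambda>p. complex_of_real (F (g p - a)))"
      by simp_all
    have "complex_of_real (F (b - t)) + complex_of_real (F (t - a)) \<noteq> 0" for t
      using pos[of t] unfolding of_real_add[symmetric] of_real_eq_0_iff by simp
    then have "smooth (\<lambda>p. inverse (complex_of_real (F (b - g p)) + complex_of_real (F (g p - a))))"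
      by (intro smooth_inverse smooth_add s)
    with s(1) show "smooth (\<lambda>p. complex_of_real (\<theta> (g p)))"
      unfolding \<theta>_def of_real_mult of_real_inverse of_real_add by (rule smooth_mult)
  qed
qed

lemma smooth_norm_square: "smooth (\<lambda>p. complex_of_real ((norm (p - c))\<^sup>2))"
proof -
  have "(norm (p - c))\<^sup>2 = (inner p (1,0) - inner c (1,0))\<^sup>2 + (inner p (0,1) - inner c (0,1))\<^sup>2" for p
    by (cases p; cases c) (simp add: norm_Pair)
  then show ?thesis
    by (simp only: of_real_add of_real_power of_real_diff)
       (intro smooth_add smooth_power smooth_diff smooth_inner smooth_const)
qed

lemma ball_cutoff:
  assumes "0 < r" "r < s"
  obtains \<kappa> where "smooth \<kappa>" "\<And>p. dist p c \<le> r \<Longrightarrow> \<kappa> p = 1" "\<And>p. s \<le> dist p c \<Longrightarrow> \<kappa> p = 0"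
proof -
  have "r\<^sup>2 < s\<^sup>2" using assms by (simp add: power_strict_mono)
  then obtain \<theta> :: "real \<Rightarrow> real" where \<theta>: "\<And>t. t \<le> r\<^sup>2 \<Longrightarrow> \<theta> t = 1" "\<And>t. s\<^sup>2 \<le> t \<Longrightarrow> \<theta> t = 0"
    "\<And>g. smooth (\<lambda>p. complex_of_real (g p)) \<Longrightarrow> smooth (\<lambda>p. complex_of_real (\<theta> (g p)))"
    using smooth_step[of "r\<^sup>2" "s\<^sup>2"] by metis
  show ?thesis
  proof (rule that)
    show "smooth (\<lambda>p. complex_of_real (\<theta> ((norm (p - c))\<^sup>2)))"
      by (intro \<theta>(3) smooth_norm_square)
    show "complex_of_real (\<theta> ((norm (p - c))\<^sup>2)) = 1" if "dist p c \<le> r" for p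
      using that by (simp add: \<theta>(1) dist_norm power_mono)
    show "complex_of_real (\<theta> ((norm (p - c))\<^sup>2)) = 0" if "s \<le> dist p c" for p
      using that assms by (simp add: \<theta>(2) dist_norm power_mono)
  qed
qed

lemma partials_zero_on_open:
  assumes "open U" "\<And>p. p \<in> U \<Longrightarrow> f p = 0" "smooth f" "vs \<in> lists Basis" "p \<in> U"
  shows "partials vs f p = 0"
proof -
  have "partials vs f p = partials vs (\<lambda>p. 0) p"
    using assms by (intro partials_local[of U]) auto
  then show ?thesis by (cases "vs = []") (simp_all add: partials_const)
qed

lemma slow_space_0I:
  assumes "smooth f" "\<And>vs. vs \<in> lists Basis \<Longrightarrow> \<exists>C. \<forall>p. cmod (partials vs f p) \<le> C"
  shows "f \<in> slow_space 0"
  using assms by (simp add: slow_space_iff)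

text \<open>The derivatives are continuous on the compact support and vanish on its open complement.\<close>

lemma compact_support_slow_space:
  assumes f: "smooth f" and K: "compact (fun_support f)"
  shows "f \<in> slow_space 0"
proof (rule slow_space_0I[OF f])
  fix vs :: "(real \<times> real) list" assume vs: "vs \<in> lists Basis"
  have cont: "continuous_on (fun_support f) (partials vs f)"
    by (intro continuous_at_imp_continuous_on ballI differentiable_imp_continuous_within
        smooth_differentiable smooth_partials f vs)
  obtain C where "\<forall>p\<in>fun_support f. cmod (partials vs f p) \<le> C"
    using compact_imp_bounded[OF compact_continuous_image[OF cont K]] by (auto simp: bounded_iff)
  moreover have "partials vs f p = 0" if "p \<notin> fun_support f" for p
  proof (rule partials_zero_on_open[OF _ _ f vs])
    show "open (- fun_support f)" by (simp add: fun_support_def open_Compl)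
    show "f q = 0" if "q \<in> - fun_support f" for q
      using that closure_subset[of "{p. f p \<noteq> 0}"] unfolding fun_support_def by blast
  qed (use that in simp)
  ultimately show "\<exists>C. \<forall>p. cmod (partials vs f p) \<le> C"
    by (metis max.cobounded1 max.cobounded2 norm_zero order_trans)
qed

text \<open>A function of one coordinate alone has noncompact support in the plane, but its derivatives are
  invariant under translation along the other axis, so they are bounded by their values on a
  compact segment of the axis spanned by \<open>v\<close>.\<close>

lemma coordinate_support_slow_space:
  assumes f: "smooth f" and v: "v \<in> Basis"
    and inv: "\<And>p. f p = f (inner p v *\<^sub>R v)"
    and van: "\<And>p. r < \<bar>inner p v\<bar> \<Longrightarrow> f p = 0"
  shows "f \<in> slow_space 0"
proof (rule slow_space_0I[OF f])
  fix vs :: "(real \<times> real) list" assume vs: "vs \<in> lists Basis"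
  define h where "h = partials vs f"
  have vv: "inner v v = 1" using v by (simp add: inner_Basis)
  have h_inv: "h p = h (inner p v *\<^sub>R v)" for p
  proof -
    \<comment> \<open>the translation along the other axis that moves \<open>p\<close> to the axis spanned by \<open>v\<close>\<close>
    define a where "a = inner p v *\<^sub>R v - p"
    have a: "inner a v = 0" by (simp add: a_def inner_diff_left vv)
    have "f (1 *\<^sub>R q + a) = f q" for q
    proof -
      have "inner (q + a) v = inner q v" by (simp add: inner_add_left a)
      with inv[of "q + a"] have "f (q + a) = f (inner q v *\<^sub>R v)" by (simp only:)
      also have "\<dots> = f q" by (rule inv[symmetric])
      finally show ?thesis by (simp only: scaleR_one)
    qed
    then have eq: "(\<lambda>q. f (1 *\<^sub>R q + a)) = f" by (rule ext)
    have "partials vs f p = partials vs f (1 *\<^sub>R p + a)"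
      using fun_cong[OF partials_affine[OF f vs, of 1 a, unfolded eq], of p]
      by (simp only: of_real_1 power_one mult_1_left)
    moreover have "1 *\<^sub>R p + a = inner p v *\<^sub>R v" by (simp add: a_def)
    ultimately show ?thesis by (simp only: h_def)
  qed
  let ?K = "(\<lambda>t. t *\<^sub>R v) ` {- r..r}"
  have K: "compact ?K" by (intro compact_continuous_image continuous_intros compact_Icc)
  have cont: "continuous_on ?K h" unfolding h_def
    by (intro continuous_at_imp_continuous_on ballI differentiable_imp_continuous_within
        smooth_differentiable smooth_partials f vs)
  obtain C where C: "\<forall>p\<in>?K. cmod (h p) \<le> C"
    using compact_imp_bounded[OF compact_continuous_image[OF cont K]] by (auto simp: bounded_iff)
  have "h p = 0" if "r < \<bar>inner p v\<bar>" for p unfolding h_def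
  proof (rule partials_zero_on_open[OF _ van f vs])
    show "open {p. r < \<bar>inner p v\<bar>}" by (intro open_Collect_less continuous_intros)
  qed (use that in auto)
  moreover have "cmod (h p) \<le> C" if "\<bar>inner p v\<bar> \<le> r" for p
  proof -
    have "inner p v \<in> {- r..r}" using that by auto
    with C show ?thesis unfolding h_inv[of p] by blast
  qed
  ultimately have "cmod (h p) \<le> max C 0" for p
    by (metis linorder_not_less max.cobounded1 max.cobounded2 norm_zero order_trans)
  then show "\<exists>C. \<forall>p. cmod (partials vs f p) \<le> C"
    unfolding h_def by blast
qed

section \<open>Kernels see only a neighbourhood of their support\<close>

lemma kernel_add:
  "generalized_kernel u \<Longrightarrow> f \<in> slow_funs \<Longrightarrow> g \<in> slow_funs \<Longrightarrow> u (\<lambda>p. f p + g p) = u f + u g"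
  unfolding generalized_kernel_def by blast

lemma kernel_cmult:
  "generalized_kernel u \<Longrightarrow> f \<in> slow_funs \<Longrightarrow> u (\<lambda>p. c * f p) = c * u f"
  unfolding generalized_kernel_def by blast

lemma kernel_diff:
  assumes "generalized_kernel u" "f \<in> slow_funs" "g \<in> slow_funs"
  shows "u (\<lambda>p. f p - g p) = u f - u g"
  using kernel_add[OF assms(1,2) slow_funs_mult[OF slow_funs_const assms(3)], of "-1"]
    kernel_cmult[OF assms(1,3), of "-1"] by simp

lemma kernel_zero: "generalized_kernel u \<Longrightarrow> u (\<lambda>p. 0) = 0"
  using kernel_cmult[of u "\<lambda>p. 0" 0] slow_funs_const by simp

lemma kernel_sum:
  assumes "generalized_kernel u" "\<And>i. i \<in> I \<Longrightarrow> f i \<in> slow_funs"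
  shows "u (\<lambda>p. \<Sum>i\<in>I. f i p) = (\<Sum>i\<in>I. u (f i))"
  using assms(2)
proof (induction I rule: infinite_finite_induct)
  case (insert i I)
  then show ?case
    using kernel_add[OF assms(1), of "f i" "\<lambda>p. \<Sum>i\<in>I. f i p"] slow_funs_sum[of I f] by simp
qed (simp_all add: kernel_zero assms)

text \<open>Continuity of a kernel on one step of the inductive limit, in the form in which it is used: uniform
  decay of every weighted derivative, with a rate that may depend on the derivative.\<close>

lemma kernel_tendsto_0:
  assumes u: "generalized_kernel u" and F: "\<And>n. smooth (F n)"
    and b: "\<And>vs. vs \<in> lists Basis \<Longrightarrow>
      \<exists>b. b \<longlonglongrightarrow> 0 \<and> (\<forall>n p. cmod (partials vs (F n) p) \<le> b n * (1 + (norm p)\<^sup>2) ^ k)"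
  shows "(\<lambda>n. u (F n)) \<longlonglongrightarrow> 0"
proof -
  have pos: "0 < (1 + (norm p)\<^sup>2) ^ k" for p :: "real \<times> real"
    by (intro zero_less_power add_pos_nonneg) auto
  have Fk: "F n \<in> slow_space k" for n
    unfolding slow_space_iff using F b by blast
  have lim: "(\<lambda>n. slow_seminorm k vs (F n)) \<longlonglongrightarrow> 0" if vs: "vs \<in> lists Basis" for vs
  proof -
    obtain b where b0: "b \<longlonglongrightarrow> 0"
      and b: "\<And>n p. cmod (partials vs (F n) p) \<le> b n * (1 + (norm p)\<^sup>2) ^ k"
      using b[OF vs] by blast
    have q: "slow_quotient k vs (F n) p \<le> b n" for n p
      using b pos by (simp add: slow_quotient_def divide_le_eq)
    have "slow_seminorm k vs (F n) \<le> b n" for n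
      unfolding slow_seminorm_def by (rule cSUP_least) (simp_all add: q)
    moreover have "0 \<le> slow_seminorm k vs (F n)" for n
      unfolding slow_seminorm_def
    proof (rule cSUP_upper2[where x=0])
      show "bdd_above (range (slow_quotient k vs (F n)))"
        using q unfolding bdd_above_def by blast
    qed (simp_all add: slow_quotient_def)
    ultimately show ?thesis
      by (intro tendsto_sandwich[OF _ _ tendsto_const b0] always_eventually allI)
  qed
  have "\<exists>m C. \<forall>f\<in>slow_space k.
      cmod (u f) \<le> C * (\<Sum>vs | vs \<in> lists Basis \<and> length vs \<le> m. slow_seminorm k vs f)"
    using u unfolding generalized_kernel_def by blast
  then obtain m C where C: "\<And>f. f \<in> slow_space k \<Longrightarrow>
      cmod (u f) \<le> C * (\<Sum>vs | vs \<in> lists Basis \<and> length vs \<le> m. slow_seminorm k vs f)"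
    by blast
  have "(\<lambda>n. \<Sum>vs | vs \<in> lists Basis \<and> length vs \<le> m. slow_seminorm k vs (F n))
      \<longlonglongrightarrow> (\<Sum>vs | vs \<in> lists (Basis :: (real \<times> real) set) \<and> length vs \<le> m. 0)"
    by (rule tendsto_sum, rule lim) simp
  from tendsto_mult[OF tendsto_const this, of C]
  have "(\<lambda>n. C * (\<Sum>vs | vs \<in> lists Basis \<and> length vs \<le> m. slow_seminorm k vs (F n)))
      \<longlonglongrightarrow> 0" by simp
  then show ?thesis
    by (rule Lim_null_comparison[OF always_eventually[OF allI[OF C[OF Fk]]]])
qed

lemma test_functions_slow: "f \<in> test_functions \<Longrightarrow> f \<in> slow_funs"
  unfolding test_functions_def slow_funs_def using compact_support_slow_space by blast

lemma test_functions_mult: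
  assumes "f \<in> test_functions" "smooth g"
  shows "(\<lambda>p. f p * g p) \<in> test_functions"
    and "fun_support (\<lambda>p. f p * g p) \<subseteq> fun_support f"
proof -
  show sub: "fun_support (\<lambda>p. f p * g p) \<subseteq> fun_support f"
    unfolding fun_support_def by (rule closure_mono) auto
  have "compact (fun_support f \<inter> fun_support (\<lambda>p. f p * g p))"
    using assms(1) unfolding test_functions_def
    by (intro compact_Int_closed) (auto simp: fun_support_def)
  with sub have "compact (fun_support (\<lambda>p. f p * g p))"
    by (simp add: Int_absorb1)
  with assms show "(\<lambda>p. f p * g p) \<in> test_functions"
    unfolding test_functions_def by blast
qed

text \<open>Passing from local to global vanishing, with a product instead of a partition of unity. The compact
  support of \<open>f\<close> is covered by finitely many balls with cutoffs \<open>\<kappa> p\<close> that are one on the ball and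
  supported in a region where \<open>u\<close> vanishes. Multiplying by \<open>1 - \<kappa> p\<close> does not change the value of \<open>u\<close>, but
  the product of all these factors annihilates \<open>f\<close>.\<close>

lemma null_off_support:
  assumes u: "generalized_kernel u" and f: "f \<in> test_functions"
    and disj: "fun_support f \<inter> dist_support u = {}"
  shows "u f = 0"
proof -
  define S where "S = fun_support f"
  define Q where "Q p e \<kappa> \<longleftrightarrow> 0 < e \<and> smooth \<kappa> \<and> (\<forall>q. dist q p \<le> e \<longrightarrow> \<kappa> q = 1) \<and>
      (\<forall>g\<in>test_functions. u (\<lambda>q. g q * \<kappa> q) = 0)" for p e \<kappa>
  have "\<exists>e \<kappa>. Q p e \<kappa>" if "p \<in> S" for p
  proof -
    have "p \<in> \<Union>{U. open U \<and> (\<forall>f\<in>test_functions. fun_support f \<subseteq> U \<longrightarrow> u f = 0)}"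
      using that disj unfolding dist_support_def S_def by blast
    then obtain U where U: "open U" "p \<in> U" "\<And>g. g \<in> test_functions \<Longrightarrow> fun_support g \<subseteq> U \<Longrightarrow> u g = 0"
      by blast
    obtain e where e: "0 < e" "cball p e \<subseteq> U"
      using U(1,2) unfolding open_contains_cball by blast
    obtain \<kappa> where \<kappa>: "smooth \<kappa>" "\<And>q. dist q p \<le> e / 2 \<Longrightarrow> \<kappa> q = 1" "\<And>q. e \<le> dist q p \<Longrightarrow> \<kappa> q = 0"
      using ball_cutoff[of "e / 2" e p] e(1) by auto
    have "u (\<lambda>q. g q * \<kappa> q) = 0" if g: "g \<in> test_functions" for g
    proof (rule U(3))
      show "(\<lambda>q. g q * \<kappa> q) \<in> test_functions"
        using test_functions_mult(1)[OF g \<kappa>(1)] .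
      have "{q. g q * \<kappa> q \<noteq> 0} \<subseteq> cball p e"
        using \<kappa>(3) by (force simp: dist_commute)
      then have "fun_support (\<lambda>q. g q * \<kappa> q) \<subseteq> cball p e"
        unfolding fun_support_def by (intro closure_minimal) auto
      with e(2) show "fun_support (\<lambda>q. g q * \<kappa> q) \<subseteq> U" by blast
    qed
    with \<kappa> e(1) have "Q p (e / 2) \<kappa>"
      unfolding Q_def by simp
    then show ?thesis by blast
  qed
  then obtain e \<kappa> where Q: "\<And>p. p \<in> S \<Longrightarrow> Q p (e p) (\<kappa> p)"
    by metis
  then have e: "\<And>p. p \<in> S \<Longrightarrow> 0 < e p" and \<kappa>: "\<And>p. p \<in> S \<Longrightarrow> smooth (\<kappa> p)"
    "\<And>p q. p \<in> S \<Longrightarrow> dist q p \<le> e p \<Longrightarrow> \<kappa> p q = 1"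
    "\<And>p g. p \<in> S \<Longrightarrow> g \<in> test_functions \<Longrightarrow> u (\<lambda>q. g q * \<kappa> p q) = 0"
    unfolding Q_def by blast+
  have prod: "(\<lambda>q. f q * (\<Prod>p\<in>I. 1 - \<kappa> p q)) \<in> test_functions \<and>
      u (\<lambda>q. f q * (\<Prod>p\<in>I. 1 - \<kappa> p q)) = u f" if "finite I" "I \<subseteq> S" for I
    using that
  proof (induction I rule: finite_induct)
    case empty
    show ?case using f by simp
  next
    case (insert p I)
    define g where "g = (\<lambda>q. f q * (\<Prod>p\<in>I. 1 - \<kappa> p q))"
    have g: "g \<in> test_functions" "u g = u f" and p: "p \<in> S"
      using insert by (auto simp: g_def)
    have eq: "(\<lambda>q. f q * (\<Prod>p\<in>insert p I. 1 - \<kappa> p q)) = (\<lambda>q. g q * (1 - \<kappa> p q))"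
      using insert(1,2) by (auto simp: g_def mult_ac)
    have "(\<lambda>q. g q * (1 - \<kappa> p q)) \<in> test_functions"
      using \<kappa>(1)[OF p] by (intro test_functions_mult(1)[OF g(1)] smooth_diff smooth_const)
    moreover have "u (\<lambda>q. g q * (1 - \<kappa> p q)) = u g - u (\<lambda>q. g q * \<kappa> p q)"
      using kernel_diff[OF u, of g "\<lambda>q. g q * \<kappa> p q"] g(1) test_functions_mult(1)[OF g(1) \<kappa>(1)[OF p]]
      by (simp add: test_functions_slow right_diff_distrib)
    ultimately show ?case
      unfolding eq using g \<kappa>(3)[OF p g(1)] by simp
  qed
  have "compact S" using f by (simp add: S_def test_functions_def)
  then obtain I where I: "I \<subseteq> S" "finite I" "S \<subseteq> (\<Union>p\<in>I. ball p (e p))"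
    by (rule compactE_image[where C=S and f="\<lambda>p. ball p (e p)"]) (use e in force)+
  have "f q * (\<Prod>p\<in>I. 1 - \<kappa> p q) = 0" for q
  proof (cases "q \<in> S")
    case True
    with I obtain p where p: "p \<in> I" "dist p q < e p" by auto
    with I \<kappa>(2)[of p q] have "1 - \<kappa> p q = 0" by (auto simp: dist_commute)
    with p(1) I(2) show ?thesis by (auto simp: prod_zero_iff)
  next
    case False
    then show ?thesis
      using closure_subset[of "{p. f p \<noteq> 0}"] unfolding S_def fun_support_def by auto
  qed
  with prod[OF I(2,1)] kernel_zero[OF u] show ?thesis by simp
qed

text \<open>The truncations \<open>f(p) \<kappa>(p/R)\<close> are test functions supported away from the support of \<open>u\<close>, so \<open>u\<close>
  annihilates them. The remainders \<open>f(p) (1 - \<kappa>(p/R))\<close> live on \<open>|p| \<ge> R\<close>; there one more power of the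
  weight gains a factor \<open>1/R\<close>, and the derivatives of \<open>\<kappa>(p/R)\<close> stay bounded. Hence the
  remainders tend to zero in \<open>slow_space (k + 1)\<close>, and \<open>u f\<close>, being their constant image, is zero.\<close>

lemma null_near_support:
  assumes u: "generalized_kernel u" and f: "f \<in> slow_funs"
    and U: "open U" "dist_support u \<subseteq> U" "\<And>p. p \<in> U \<Longrightarrow> f p = 0"
  shows "u f = 0"
proof -
  obtain k where k: "f \<in> slow_space k" using f unfolding slow_funs_def by blast
  have sf: "smooth f" using slow_space_smooth[OF k] .
  obtain \<kappa> where \<kappa>: "smooth \<kappa>" "\<And>q. dist q 0 \<le> 1 \<Longrightarrow> \<kappa> q = 1" "\<And>q. 2 \<le> dist q 0 \<Longrightarrow> \<kappa> q = 0"
    using ball_cutoff[of 1 2 0] by auto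
  have "{q. \<kappa> q \<noteq> 0} \<subseteq> cball 0 2"
    using \<kappa>(3) by (force simp: dist_commute)
  then have "fun_support \<kappa> \<subseteq> cball 0 2"
    unfolding fun_support_def by (intro closure_minimal) auto
  then have "compact (fun_support \<kappa>)"
    using compact_Int_closed[OF compact_cball, of "fun_support \<kappa>" 0 2]
    by (simp add: fun_support_def Int_absorb1)
  then have "(\<lambda>p. 1 + (-1) * \<kappa> p) \<in> slow_space 0"
    by (intro slow_space_add slow_space_const slow_space_cmult compact_support_slow_space \<kappa>(1))
  moreover define \<mu> where "\<mu> = (\<lambda>p. 1 + (-1) * \<kappa> p)"
  ultimately have \<mu>: "\<mu> \<in> slow_space 0" by simp
  \<comment> \<open>the reciprocal \<open>1/R\<close> of the radius of truncation\<close>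
  define c where "c n = inverse (1 + real n)" for n
  have c: "0 < c n" "c n \<le> 1" for n by (auto simp: c_def field_simps)
  define \<mu>' where "\<mu>' n = (\<lambda>p. \<mu> (c n *\<^sub>R p + 0))" for n
  have s\<mu>': "smooth (\<mu>' n)" for n
    unfolding \<mu>'_def by (rule smooth_affine[OF slow_space_smooth[OF \<mu>]])
  have jet_\<mu>': "jet m (\<mu>' n) p \<le> jet m \<mu> (c n *\<^sub>R p)" for m n p
    unfolding jet_def
  proof (rule sum_mono)
    fix ws assume "ws \<in> multi_indices m"
    then have ws: "ws \<in> lists Basis" by (simp add: multi_indices_def)
    have "cmod (partials ws (\<mu>' n) p) = c n ^ length ws * cmod (partials ws \<mu> (c n *\<^sub>R p))"
      unfolding \<mu>'_def using c(1)[of n]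
      by (simp only: partials_affine[OF slow_space_smooth[OF \<mu>] ws]) (simp add: norm_mult norm_power)
    also have "\<dots> \<le> 1 * cmod (partials ws \<mu> (c n *\<^sub>R p))"
      using c[of n] by (intro mult_right_mono power_le_one) auto
    finally show "cmod (partials ws (\<mu>' n) p) \<le> cmod (partials ws \<mu> (c n *\<^sub>R p))" by simp
  qed
  define F where "F n = (\<lambda>p. f p * \<mu>' n p)" for n
  have "(\<lambda>n. u (F n)) \<longlonglongrightarrow> 0"
  proof (rule kernel_tendsto_0[OF u, where k="k + 1"])
    show "smooth (F n)" for n unfolding F_def using sf s\<mu>' by (rule smooth_mult)
    fix vs :: "(real \<times> real) list" assume vs: "vs \<in> lists Basis"
    let ?m = "length vs"
    obtain C where C: "0 \<le> C" "\<And>p. jet ?m f p \<le> C * (1 + (norm p)\<^sup>2) ^ k"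
      using slow_space_jet[OF k] by blast
    obtain D where D: "0 \<le> D" "\<And>p. jet ?m \<mu> p \<le> D * (1 + (norm p)\<^sup>2) ^ 0"
      using slow_space_jet[OF \<mu>] by blast
    define b where "b n = (2 ^ ?m * (C * D)) * inverse (real (Suc n))" for n
    have "b \<longlonglongrightarrow> (2 ^ ?m * (C * D)) * 0" unfolding b_def
      by (intro tendsto_mult tendsto_const LIMSEQ_inverse_real_of_nat)
    moreover have "cmod (partials vs (F n) p) \<le> b n * (1 + (norm p)\<^sup>2) ^ (k + 1)" for n p
    proof (cases "norm p < 1 + real n")
      case True
      have "F n q = 0" if "q \<in> ball 0 (1 + real n)" for q
      proof -
        have "norm (c n *\<^sub>R q) \<le> 1" using that by (simp add: c_def field_simps)
        then show ?thesis using \<kappa>(2)[of "c n *\<^sub>R q"] by (simp add: F_def \<mu>'_def \<mu>_def)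
      qed
      with True vs \<open>smooth (F n)\<close> have "partials vs (F n) p = 0"
        by (intro partials_zero_on_open[of "ball 0 (1 + real n)"]) auto
      moreover have "0 \<le> b n" using C D by (simp add: b_def)
      ultimately show ?thesis by simp
    next
      case False
      let ?W = "1 + (norm p)\<^sup>2" and ?R = "real (Suc n)"
      have "?R \<le> ?R\<^sup>2" by (simp add: power2_eq_square)
      also have "\<dots> \<le> (norm p)\<^sup>2" using False by (intro power_mono) auto
      finally have WR: "1 \<le> inverse ?R * ?W" by (simp add: field_simps)
      have jet_D: "jet ?m (\<mu>' n) p \<le> D"
        using order_trans[OF jet_\<mu>' D(2)] by simp
      have "cmod (partials vs (F n) p) \<le> 2 ^ ?m * (jet ?m f p * jet ?m (\<mu>' n) p)"
        unfolding F_def using sf s\<mu>' vs by (rule partials_mult_bound)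
      also have "\<dots> \<le> 2 ^ ?m * ((C * ?W ^ k) * D)"
        using C D(1) jet_D
        by (intro mult_left_mono mult_mono jet_nonneg) auto
      also have "\<dots> = (2 ^ ?m * (C * D) * ?W ^ k) * 1" by (simp add: mult_ac)
      also have "\<dots> \<le> (2 ^ ?m * (C * D) * ?W ^ k) * (inverse ?R * ?W)"
        using C(1) D(1) by (intro mult_left_mono WR) auto
      also have "\<dots> = b n * ?W ^ (k + 1)" by (simp add: b_def)
      finally show ?thesis .
    qed
    ultimately show "\<exists>b. b \<longlonglongrightarrow> 0 \<and> (\<forall>n p. cmod (partials vs (F n) p) \<le> b n * (1 + (norm p)\<^sup>2) ^ (k + 1))"
      by auto
  qed
  moreover have "u (F n) = u f" for n
  proof -
    define g where "g = (\<lambda>p. f p * \<kappa> (c n *\<^sub>R p + 0))"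
    have "{p. g p \<noteq> 0} \<subseteq> cball 0 (2 * (1 + real n))"
    proof safe
      fix p assume "g p \<noteq> 0"
      then have "\<kappa> (c n *\<^sub>R p) \<noteq> 0" by (auto simp: g_def)
      with \<kappa>(3) have "\<not> 2 \<le> dist (c n *\<^sub>R p) 0" by blast
      then have "norm (c n *\<^sub>R p) < 2" by (simp only: dist_0_norm dist_commute not_le)
      then show "p \<in> cball 0 (2 * (1 + real n))" by (simp add: c_def field_simps)
    qed
    then have "fun_support g \<subseteq> cball 0 (2 * (1 + real n))"
      unfolding fun_support_def by (intro closure_minimal) auto
    then have "compact (fun_support g)"
      using compact_Int_closed[OF compact_cball, of "fun_support g" 0 "2 * (1 + real n)"]
      by (simp add: fun_support_def Int_absorb1)
    moreover have "smooth g" unfolding g_def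
      by (intro smooth_mult sf smooth_affine \<kappa>(1))
    ultimately have g: "g \<in> test_functions" by (simp add: test_functions_def)
    have "fun_support g \<subseteq> - U"
      unfolding fun_support_def using U by (intro closure_minimal) (auto simp: g_def)
    with U(2) have "u g = 0" by (intro null_off_support[OF u g]) blast
    moreover have "F n = (\<lambda>p. f p - g p)"
      by (auto simp: F_def \<mu>'_def \<mu>_def g_def algebra_simps)
    ultimately show ?thesis
      using kernel_diff[OF u f test_functions_slow[OF g]] by simp
  qed
  ultimately show ?thesis by (simp add: LIMSEQ_const_iff)
qed

text \<open>Any two extensions of \<open>f(x) g(y)\<close> from a neighbourhood of the support differ by a function that
  vanishes near the support, so the definite description in the definition is unambiguous.\<close>

lemma pairing_eq:
  assumes u: "generalized_kernel u" and \<phi>: "\<phi> \<in> slow_funs" and U: "open U" "dist_support u \<subseteq> U"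
    and eq: "\<And>x y. (x, y) \<in> U \<Longrightarrow> \<phi> (x, y) = f x * g y"
  shows "pairing u f g = u \<phi>"
  unfolding pairing_def
proof (rule the_equality)
  show "\<exists>\<psi>\<in>slow_funs. \<exists>U. open U \<and> dist_support u \<subseteq> U \<and>
      (\<forall>x y. (x, y) \<in> U \<longrightarrow> \<psi> (x, y) = f x * g y) \<and> u \<phi> = u \<psi>"
    using assms by blast
next
  fix c assume "\<exists>\<psi>\<in>slow_funs. \<exists>V. open V \<and> dist_support u \<subseteq> V \<and>
      (\<forall>x y. (x, y) \<in> V \<longrightarrow> \<psi> (x, y) = f x * g y) \<and> c = u \<psi>"
  then obtain \<psi> V where \<psi>: "\<psi> \<in> slow_funs" "open V" "dist_support u \<subseteq> V"
    "\<And>x y. (x, y) \<in> V \<Longrightarrow> \<psi> (x, y) = f x * g y" "c = u \<psi>"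
    by blast
  have "u (\<lambda>p. \<psi> p - \<phi> p) = 0"
  proof (rule null_near_support[OF u, of _ "U \<inter> V"])
    fix p assume "p \<in> U \<inter> V"
    then show "\<psi> p - \<phi> p = 0" using eq \<psi>(4) by (cases p) simp
  qed (use assms \<psi> in auto)
  then show "c = u \<phi>" using kernel_diff[OF u \<psi>(1) \<phi>] \<psi>(5) by simp
qed

section \<open>Geometric expansion of the resolvent\<close>

text \<open>With \<open>\<sigma>\<close> an \<open>m\<close>-th root of \<open>\<rho>\<close>, the sequence is the \<open>m\<close>-th power of the null sequence
  \<open>(n + 1) \<sigma>\<^sup>n\<close>.\<close>

lemma poly_times_geometric_tendsto_0:
  fixes \<rho> :: real
  assumes "0 \<le> \<rho>" "\<rho> < 1"
  shows "(\<lambda>n. real (Suc n) ^ m * \<rho> ^ n) \<longlonglongrightarrow> 0"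
proof (cases "m = 0")
  case True
  then show ?thesis using assms by (simp add: LIMSEQ_realpow_zero)
next
  case False
  define \<sigma> where "\<sigma> = root m \<rho>"
  have \<sigma>: "\<sigma> ^ m = \<rho>" "0 \<le> \<sigma>" "\<sigma> < 1"
    using False assms by (auto simp: \<sigma>_def)
  have "(\<lambda>n. real n * \<sigma> ^ n + \<sigma> ^ n) \<longlonglongrightarrow> 0 + 0"
    using \<sigma> powser_times_n_limit_0[of \<sigma>] by (intro tendsto_add LIMSEQ_realpow_zero) auto
  then have "(\<lambda>n. (real (Suc n) * \<sigma> ^ n) ^ m) \<longlonglongrightarrow> 0 ^ m"
    by (intro tendsto_power) (simp add: algebra_simps)
  moreover have "(real (Suc n) * \<sigma> ^ n) ^ m = real (Suc n) ^ m * \<rho> ^ n" for n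
    unfolding \<sigma>(1)[symmetric] by (simp add: power_mult_distrib power_mult[symmetric] mult.commute)
  ultimately show ?thesis using False by (simp only: power_0_left if_False)
qed

text \<open>Each derivative of \<open>w\<^sup>n\<close> costs a factor \<open>n\<close> and one power of \<open>w\<close>, hence a factor \<open>(n + 1) / r\<close>,
  while the geometric rate \<open>r\<^sup>n\<close> survives. The factor \<open>g\<close> must vary in the induction because it absorbs
  the derivatives of \<open>w\<close>.\<close>

lemma partials_power_bound:
  assumes w: "w \<in> slow_space 0" and r: "0 < r" "\<And>p. cmod (w p) \<le> r"
    and g: "g \<in> slow_space k" and vs: "vs \<in> lists Basis"
  shows "\<exists>C. \<forall>n p. cmod (partials vs (\<lambda>p. g p * w p ^ n) p)
           \<le> C * (real (Suc n) ^ length vs * r ^ n) * (1 + (norm p)\<^sup>2) ^ k"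
  using vs g
proof (induction vs arbitrary: g rule: rev_induct)
  case Nil
  obtain C where C: "0 \<le> C" "\<And>p. cmod (partials [] g p) \<le> C * (1 + (norm p)\<^sup>2) ^ k"
    using slow_spaceE[OF Nil(2) Nil(1)] by blast
  have "cmod (g p) * cmod (w p) ^ n \<le> (C * (1 + (norm p)\<^sup>2) ^ k) * r ^ n" for n p
    using C r by (intro mult_mono power_mono) auto
  then show ?case by (intro exI[of _ C]) (simp add: norm_mult norm_power mult_ac)
next
  case (snoc v vs)
  let ?m = "length vs"
  have v: "v \<in> Basis" and vs: "vs \<in> lists Basis" using snoc.prems by auto
  have sg: "smooth g" and sw: "smooth w" using snoc.prems w slow_space_smooth by blast+
  let ?g1 = "partials [v] g" and ?g2 = "\<lambda>p. g p * partials [v] w p"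
  have g1: "?g1 \<in> slow_space k" using slow_space_partial[OF snoc.prems(2) v] .
  have g2: "?g2 \<in> slow_space k"
    using slow_space_mult[OF snoc.prems(2) slow_space_partial[OF w v]] by simp
  obtain A where A: "\<And>n p. cmod (partials vs (\<lambda>p. ?g1 p * w p ^ n) p)
           \<le> A * (real (Suc n) ^ ?m * r ^ n) * (1 + (norm p)\<^sup>2) ^ k"
    using snoc.IH[OF vs g1] by blast
  obtain B where B: "\<And>n p. cmod (partials vs (\<lambda>p. ?g2 p * w p ^ n) p)
           \<le> B * (real (Suc n) ^ ?m * r ^ n) * (1 + (norm p)\<^sup>2) ^ k"
    using snoc.IH[OF vs g2] by blast
  have nonneg: "0 \<le> A" "0 \<le> B"
    using order_trans[OF norm_ge_zero A[of 0 0]] order_trans[OF norm_ge_zero B[of 0 0]] by auto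
  have D: "partials [v] (\<lambda>p. w p ^ n) p = of_nat n * w p ^ (n - 1) * partials [v] w p" for n p
    by (rule partials_1)
       (rule has_derivative_eq_rhs[OF has_derivative_power[OF has_derivative_partials[OF smooth_differentiable[OF sw]]]],
        simp add: fun_eq_iff mult_ac)
  have eq: "partials (vs @ [v]) (\<lambda>p. g p * w p ^ n) p =
      partials vs (\<lambda>p. ?g1 p * w p ^ n) p + of_nat n * partials vs (\<lambda>p. ?g2 p * w p ^ (n - 1)) p" for n p
  proof -
    have "partials [v] (\<lambda>p. g p * w p ^ n) =
        (\<lambda>p. ?g1 p * w p ^ n + of_nat n * (?g2 p * w p ^ (n - 1)))"
    proof
      fix p
      show "partials [v] (\<lambda>p. g p * w p ^ n) p =
        ?g1 p * w p ^ n + of_nat n * (?g2 p * w p ^ (n - 1))"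
        by (subst partial_mult)
           (use sg sw in \<open>auto simp: D mult_ac intro!: smooth_differentiable smooth_power\<close>)
    qed
    moreover have "smooth (\<lambda>p. ?g1 p * w p ^ n)"
      by (intro smooth_mult smooth_power smooth_partial sg sw v)
    moreover have "smooth (\<lambda>p. ?g2 p * w p ^ (n - 1))"
      by (intro smooth_mult smooth_power smooth_partial sg sw v)
    ultimately show ?thesis
      using vs by (simp add: partials_append partials_add partials_cmult smooth_mult)
  qed
  have "cmod (partials (vs @ [v]) (\<lambda>p. g p * w p ^ n) p)
      \<le> (A + B / r) * (real (Suc n) ^ Suc ?m * r ^ n) * (1 + (norm p)\<^sup>2) ^ k" for n p
  proof -
    let ?W = "(1 + (norm p)\<^sup>2) ^ k"
    have W: "0 \<le> ?W" by (intro zero_le_power add_nonneg_nonneg) auto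
    have 1: "A * (real (Suc n) ^ ?m * r ^ n) * ?W \<le> A * (real (Suc n) ^ Suc ?m * r ^ n) * ?W"
      using nonneg r W by (intro mult_right_mono mult_left_mono power_increasing) auto
    have 2: "real n * (B * (real (Suc (n - 1)) ^ ?m * r ^ (n - 1)) * ?W)
        \<le> (B / r) * (real (Suc n) ^ Suc ?m * r ^ n) * ?W"
    proof (cases n)
      case 0
      then show ?thesis using nonneg r W by simp
    next
      case (Suc j)
      have "real n * real (Suc j) ^ ?m \<le> real (Suc n) * real (Suc n) ^ ?m"
        using Suc by (intro mult_mono power_mono) auto
      then have "(real n * real (Suc j) ^ ?m) * (B * r ^ j * ?W) \<le> (real (Suc n) * real (Suc n) ^ ?m) * (B * r ^ j * ?W)"
        using nonneg r W by (intro mult_right_mono) auto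
      moreover have "(B / r) * r ^ n = B * r ^ j" using r Suc by simp
      ultimately show ?thesis using Suc r(1) by (simp add: mult_ac)
    qed
    have "cmod (partials (vs @ [v]) (\<lambda>p. g p * w p ^ n) p) \<le>
        cmod (partials vs (\<lambda>p. ?g1 p * w p ^ n) p) + real n * cmod (partials vs (\<lambda>p. ?g2 p * w p ^ (n - 1)) p)"
      unfolding eq by (rule norm_triangle_le) (simp add: norm_mult)
    also have "\<dots> \<le> A * (real (Suc n) ^ ?m * r ^ n) * ?W + real n * (B * (real (Suc (n - 1)) ^ ?m * r ^ (n - 1)) * ?W)"
      by (intro add_mono mult_left_mono A B) auto
    also have "\<dots> \<le> (A + B / r) * (real (Suc n) ^ Suc ?m * r ^ n) * ?W"
      using add_mono[OF 1 2] by (simp only: distrib_right)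
    finally show ?thesis .
  qed
  then show ?case by (intro exI[of _ "A + B / r"]) simp
qed

text \<open>With \<open>g = Q / (z - w)\<close>, the remainder of the series after \<open>n\<close> terms is \<open>g (w / z)\<^sup>n\<close>. These
  remainders tend to zero together with all derivatives, relative to the weight, because \<open>r < |z|\<close>;
  and consecutive remainders differ by \<open>Q w\<^sup>n / z\<^sup>n\<^sup>+\<^sup>1\<close>, so the series telescopes.\<close>

lemma kernel_geometric_series:
  assumes u: "generalized_kernel u" and w: "w \<in> slow_space 0"
    and r: "0 < r" "\<And>p. cmod (w p) \<le> r" "r < cmod z"
    and q: "(\<lambda>p. inverse (z - w p)) \<in> slow_space 0" and Q: "Q \<in> slow_funs"
  shows "(\<lambda>n. u (\<lambda>p. Q p * w p ^ n) / z ^ Suc n) sums u (\<lambda>p. Q p * inverse (z - w p))"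
proof -
  define g where "g = (\<lambda>p. Q p * inverse (z - w p))"
  obtain k where k: "Q \<in> slow_space k" using Q unfolding slow_funs_def by blast
  have gk: "g \<in> slow_space k" unfolding g_def using slow_space_mult[OF k q] by simp
  have slow: "g \<in> slow_funs" "w \<in> slow_funs" using gk w unfolding slow_funs_def by blast+
  have z: "z \<noteq> 0" using r by auto
  have nz: "z - w p \<noteq> 0" for p using r(2)[of p] r(3) by auto
  define e where "e n = u (\<lambda>p. inverse z ^ n * (g p * w p ^ n))" for n
  have e_eq: "e n = u (\<lambda>p. g p * w p ^ n) / z ^ n" for n
    unfolding e_def using kernel_cmult[OF u slow_funs_mult[OF slow(1) slow_funs_power[OF slow(2)]], of "inverse z ^ n" n]
    by (simp add: field_simps)
  have "e \<longlonglongrightarrow> 0"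
    unfolding e_def
  proof (rule kernel_tendsto_0[OF u, where k=k])
    have s: "smooth (\<lambda>p. g p * w p ^ n)" for n
      by (intro smooth_mult smooth_power slow_space_smooth[OF gk] slow_space_smooth[OF w])
    then show "smooth (\<lambda>p. inverse z ^ n * (g p * w p ^ n))" for n
      by (intro smooth_mult[OF smooth_const])
    fix vs :: "(real \<times> real) list" assume vs: "vs \<in> lists Basis"
    obtain C where C: "\<And>n p. cmod (partials vs (\<lambda>p. g p * w p ^ n) p)
           \<le> C * (real (Suc n) ^ length vs * r ^ n) * (1 + (norm p)\<^sup>2) ^ k"
      using partials_power_bound[OF w r(1,2) gk vs] by blast
    define b where "b n = C * (real (Suc n) ^ length vs * (r / cmod z) ^ n)" for n
    have "0 \<le> r / cmod z" "r / cmod z < 1"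
      using r(1,3) z by (simp_all add: divide_less_eq)
    then have "b \<longlonglongrightarrow> C * 0"
      unfolding b_def by (intro tendsto_mult tendsto_const poly_times_geometric_tendsto_0)
    moreover have "cmod (partials vs (\<lambda>p. inverse z ^ n * (g p * w p ^ n)) p) \<le> b n * (1 + (norm p)\<^sup>2) ^ k" for n p
    proof -
      have "cmod (partials vs (\<lambda>p. inverse z ^ n * (g p * w p ^ n)) p) =
          inverse (cmod z) ^ n * cmod (partials vs (\<lambda>p. g p * w p ^ n) p)"
        by (simp add: partials_cmult[OF s vs] norm_mult norm_power norm_inverse)
      also have "\<dots> \<le> inverse (cmod z) ^ n * (C * (real (Suc n) ^ length vs * r ^ n) * (1 + (norm p)\<^sup>2) ^ k)"
        by (intro mult_left_mono C) simp
      also have "\<dots> = b n * (1 + (norm p)\<^sup>2) ^ k"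
        by (simp add: b_def divide_inverse power_mult_distrib mult_ac)
      finally show ?thesis .
    qed
    ultimately show "\<exists>b. b \<longlonglongrightarrow> 0 \<and> (\<forall>n p.
        cmod (partials vs (\<lambda>p. inverse z ^ n * (g p * w p ^ n)) p) \<le> b n * (1 + (norm p)\<^sup>2) ^ k)"
      by auto
  qed
  then have "(\<lambda>n. e n - e (Suc n)) sums (e 0 - 0)" by (rule telescope_sums')
  moreover have "e n - e (Suc n) = u (\<lambda>p. Q p * w p ^ n) / z ^ Suc n" for n
  proof -
    have "Q p * w p ^ n = z * (g p * w p ^ n) - g p * w p ^ Suc n" for p
    proof -
      have "Q p = g p * (z - w p)" using nz[of p] by (simp add: g_def)
      show ?thesis unfolding \<open>Q p = g p * (z - w p)\<close> by (simp add: algebra_simps)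
    qed
    then have "u (\<lambda>p. Q p * w p ^ n) = z * u (\<lambda>p. g p * w p ^ n) - u (\<lambda>p. g p * w p ^ Suc n)"
      using kernel_diff[OF u slow_funs_mult[OF slow_funs_const slow_funs_mult[OF slow(1) slow_funs_power[OF slow(2)]]]
          slow_funs_mult[OF slow(1) slow_funs_power[OF slow(2)]], of z n "Suc n"]
        kernel_cmult[OF u slow_funs_mult[OF slow(1) slow_funs_power[OF slow(2)]], of z n]
      by simp
    then show ?thesis unfolding e_eq using z by (simp add: field_simps)
  qed
  ultimately show ?thesis by (simp add: e_eq g_def)
qed

text \<open>Here \<open>v\<close> is a coordinate direction and \<open>inner p v\<close> the corresponding coordinate \<open>t\<close>. The function
  \<open>1 / (z - t)\<close> may be singular and the powers of \<open>t\<close> are unbounded. Both defects disappear when \<open>t\<close> is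
  replaced by \<open>w = t \<theta>(t\<^sup>2)\<close> with a smooth step \<open>\<theta>\<close>: this function agrees with \<open>t\<close> near the support,
  depends on \<open>t\<close> only, has bounded derivatives, and stays in a disc of radius less than \<open>|z|\<close>.\<close>

lemma kernel_resolvent_expansion:
  assumes u: "generalized_kernel u" and v: "v \<in> Basis" and Q: "Q \<in> slow_funs"
    and r: "0 \<le> r" "r < cmod z" and supp: "\<And>p. p \<in> dist_support u \<Longrightarrow> \<bar>inner p v\<bar> \<le> r"
  shows "\<exists>\<phi>\<in>slow_funs. \<exists>U. open U \<and> dist_support u \<subseteq> U \<and>
    (\<forall>p\<in>U. \<phi> p = Q p / (z - complex_of_real (inner p v))) \<and>
    (\<lambda>n. u (\<lambda>p. Q p * complex_of_real (inner p v) ^ n) / z ^ Suc n) sums u \<phi>"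
proof -
  obtain r1 where r1: "r < r1" "r1 < cmod z" using dense[OF r(2)] by blast
  obtain r2 where r2: "r1 < r2" "r2 < cmod z" using dense[OF r1(2)] by blast
  have "r1\<^sup>2 < r2\<^sup>2" using r r1 r2 by (intro power_strict_mono) auto
  then obtain \<theta> where \<theta>: "\<And>t. 0 \<le> \<theta> t" "\<And>t. \<theta> t \<le> 1"
    "\<And>t. t \<le> r1\<^sup>2 \<Longrightarrow> \<theta> t = 1" "\<And>t. r2\<^sup>2 \<le> t \<Longrightarrow> \<theta> t = 0"
    "\<And>g. smooth (\<lambda>p. complex_of_real (g p)) \<Longrightarrow> smooth (\<lambda>p. complex_of_real (\<theta> (g p)))"
    using smooth_step[of "r1\<^sup>2" "r2\<^sup>2"] by metis
  define w where "w p = complex_of_real (inner p v * \<theta> ((inner p v)\<^sup>2))" for p :: "real \<times> real"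
  have vv: "inner v v = 1" using v by (simp add: inner_Basis)
  have w_coord: "w p = w (inner p v *\<^sub>R v)" for p by (simp add: w_def vv)
  have w_0: "w p = 0" if "r2 < \<bar>inner p v\<bar>" for p
  proof -
    have "r2\<^sup>2 \<le> (inner p v)\<^sup>2" using that r r1 r2 by (intro abs_le_square_iff[THEN iffD1]) auto
    then show ?thesis by (simp add: w_def \<theta>(4))
  qed
  have w_r2: "cmod (w p) \<le> r2" for p
  proof (cases "r2 < \<bar>inner p v\<bar>")
    case True
    then show ?thesis using w_0 r r1 r2 by simp
  next
    case False
    have "\<bar>inner p v\<bar> * \<theta> ((inner p v)\<^sup>2) \<le> r2 * 1"
      using False \<theta>(1,2) by (intro mult_mono) auto
    then show ?thesis using \<theta>(1) by (simp add: w_def norm_mult abs_mult)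
  qed
  have "smooth w" unfolding w_def of_real_mult
    by (intro smooth_mult smooth_inner \<theta>(5)) (simp only: of_real_power, intro smooth_power smooth_inner)
  have nz: "z - w p \<noteq> 0" for p using w_r2[of p] r2(2) by auto
  have w_slow: "w \<in> slow_space 0"
    using coordinate_support_slow_space[OF \<open>smooth w\<close> v w_coord w_0] .
  \<comment> \<open>subtracting \<open>1/z\<close> makes the reciprocal vanish where \<open>w\<close> does\<close>
  have q_slow: "(\<lambda>p. inverse (z - w p)) \<in> slow_space 0"
  proof -
    have "(\<lambda>p. inverse (z - w p) - inverse z) \<in> slow_space 0"
    proof (rule coordinate_support_slow_space[where r=r2, OF _ v])
      show "smooth (\<lambda>p. inverse (z - w p) - inverse z)"
        using nz by (intro smooth_diff smooth_inverse smooth_const \<open>smooth w\<close>)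
      show "inverse (z - w p) - inverse z = inverse (z - w (inner p v *\<^sub>R v)) - inverse z" for p
        unfolding w_coord[symmetric] ..
    qed (simp add: w_0)
    from slow_space_add[OF this slow_space_const[of "inverse z"]] show ?thesis by simp
  qed
  have "0 < r2" using r r1 r2 by simp
  note sums = kernel_geometric_series[OF u w_slow this w_r2 r2(2) q_slow Q]
  have slow: "w \<in> slow_funs" "(\<lambda>p. inverse (z - w p)) \<in> slow_funs"
    using w_slow q_slow unfolding slow_funs_def by blast+
  define U where "U = {p :: real \<times> real. \<bar>inner p v\<bar> < r1}"
  have U: "open U" "dist_support u \<subseteq> U"
    unfolding U_def using supp r1 by (auto intro!: open_Collect_less continuous_intros intro: le_less_trans)
  have w_U: "w p = complex_of_real (inner p v)" if "p \<in> U" for p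
  proof -
    have "(inner p v)\<^sup>2 \<le> r1\<^sup>2" using that r r1 unfolding U_def by (intro abs_le_square_iff[THEN iffD1]) auto
    then show ?thesis by (simp add: w_def \<theta>(3))
  qed
  have "u (\<lambda>p. Q p * w p ^ n) = u (\<lambda>p. Q p * complex_of_real (inner p v) ^ n)" for n
  proof -
    have *: "(\<lambda>p. Q p * w p ^ n) \<in> slow_funs" "(\<lambda>p. Q p * complex_of_real (inner p v) ^ n) \<in> slow_funs"
      by (intro slow_funs_mult slow_funs_power Q slow slow_funs_inner)+
    have "u (\<lambda>p. Q p * w p ^ n - Q p * complex_of_real (inner p v) ^ n) = 0"
      by (rule null_near_support[OF u slow_funs_diff[OF *] U]) (simp add: w_U)
    then show ?thesis using kernel_diff[OF u *] by simp
  qed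
  with sums have "(\<lambda>n. u (\<lambda>p. Q p * complex_of_real (inner p v) ^ n) / z ^ Suc n)
      sums u (\<lambda>p. Q p * inverse (z - w p))"
    by simp
  moreover have "\<forall>p\<in>U. Q p * inverse (z - w p) = Q p / (z - complex_of_real (inner p v))"
    by (simp add: w_U divide_inverse)
  ultimately show ?thesis
    by (intro bexI[OF _ slow_funs_mult[OF Q slow(2)]] exI[of _ U] conjI U)
qed

section \<open>The Gauss-Borel factorization and the second kind functions\<close>

lemma smat_mult_lower:
  assumes "\<And>k. i < k \<Longrightarrow> A i k = 0"
  shows "smat_mult A B i j = (\<Sum>k\<le>i. A i k * B k j)"
  unfolding smat_mult_def by (rule suminf_finite) (auto simp: assms)

text \<open>Forward substitution, column by column.\<close>

lemma lower_unitriangular_right_inverse: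
  assumes A: "lower_unitriangular A"
  shows "\<exists>B. lower_unitriangular B \<and> smat_mult A B = smat_id"
proof -
  define B where "B = (\<lambda>j. wfrec less_than (\<lambda>b i. (if i = j then 1 else 0) - (\<Sum>k<i. A i k * b k)))"
  have B_rec: "B j i = (if i = j then 1 else 0) - (\<Sum>k<i. A i k * B j k)" for i j
    unfolding B_def by (subst wfrec[OF wf_less_than]) (simp add: cut_def)
  have B_0: "B j i = 0" if "i < j" for i j
    using that
  proof (induction i rule: less_induct)
    case (less i)
    then show ?case by (subst B_rec) auto
  qed
  have B_1: "B i i = 1" for i
    by (subst B_rec) (auto simp: B_0)
  have "smat_mult A (\<lambda>i j. B j i) i j = smat_id i j" for i j
  proof -
    have "smat_mult A (\<lambda>i j. B j i) i j = (\<Sum>k\<le>i. A i k * B j k)"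
      using A by (intro smat_mult_lower) (simp add: lower_unitriangular_def)
    also have "\<dots> = (\<Sum>k<i. A i k * B j k) + A i i * B j i"
      by (simp add: lessThan_Suc_atMost[symmetric])
    also have "\<dots> = smat_id i j"
      using A B_rec[of j i] by (simp add: lower_unitriangular_def smat_id_def)
    finally show ?thesis .
  qed
  then show ?thesis using B_0 B_1
    by (intro exI[of _ "\<lambda>i j. B j i"]) (auto simp: lower_unitriangular_def)
qed

text \<open>Entries of products are infinite series, and associativity fails in general. For lower triangular
  left factors all the sums involved are finite.\<close>

lemma smat_mult_assoc_lower:
  assumes A: "lower_unitriangular A" and B: "lower_unitriangular B"
  shows "smat_mult (smat_mult A B) C = smat_mult A (smat_mult B C)"
proof (intro ext)
  fix i j
  have A0: "\<And>i k. i < k \<Longrightarrow> A i k = 0" and B0: "\<And>i k. i < k \<Longrightarrow> B i k = 0"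
    using A B by (auto simp: lower_unitriangular_def)
  have AB: "smat_mult A B i l = (\<Sum>k\<le>i. A i k * B k l)" for i l
    using A0 by (rule smat_mult_lower)
  have BC: "smat_mult B C k j = (\<Sum>l\<le>i. B k l * C l j)" if "k \<le> i" for k
    unfolding smat_mult_def by (rule suminf_finite) (use that B0 in auto)
  have "smat_mult (smat_mult A B) C i j = (\<Sum>l\<le>i. smat_mult A B i l * C l j)"
    by (rule smat_mult_lower) (auto simp: AB B0 intro!: sum.neutral)
  also have "\<dots> = (\<Sum>l\<le>i. \<Sum>k\<le>i. A i k * (B k l * C l j))"
    by (simp add: AB sum_distrib_right mult.assoc)
  also have "\<dots> = (\<Sum>k\<le>i. \<Sum>l\<le>i. A i k * (B k l * C l j))"
    by (rule sum.swap)
  also have "\<dots> = (\<Sum>k\<le>i. A i k * smat_mult B C k j)"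
    by (simp add: BC sum_distrib_left)
  also have "\<dots> = smat_mult A (smat_mult B C) i j"
    using A0 by (rule smat_mult_lower[symmetric])
  finally show "smat_mult (smat_mult A B) C i j = smat_mult A (smat_mult B C) i j" .
qed

lemma smat_id_left: "smat_mult smat_id A = A"
proof (intro ext)
  fix i j
  have "smat_mult smat_id A i j = (\<Sum>k\<le>i. smat_id i k * A k j)"
    by (rule smat_mult_lower) (simp add: smat_id_def)
  also have "\<dots> = A i j"
    by (simp add: smat_id_def if_distrib[of "\<lambda>c. c * _"] cong: if_cong)
  finally show "smat_mult smat_id A i j = A i j" .
qed

lemma smat_id_right: "smat_mult A smat_id = A"
proof (intro ext)
  fix i j
  have "smat_mult A smat_id i j = (\<Sum>k\<in>{j}. A i k * smat_id k j)"
    unfolding smat_mult_def by (rule suminf_finite) (auto simp: smat_id_def)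
  then show "smat_mult A smat_id i j = A i j" by (simp add: smat_id_def)
qed

text \<open>A right inverse of a right inverse of \<open>A\<close> is \<open>A\<close> itself, so right inverses are two-sided. Uniqueness
  holds among all matrices, triangular or not, because associativity constrains only the two left
  factors.\<close>

lemma smat_inv_lower:
  assumes A: "lower_unitriangular A"
  shows "lower_unitriangular (smat_inv A)" and "smat_mult A (smat_inv A) = smat_id"
proof -
  obtain B where B: "lower_unitriangular B" "smat_mult A B = smat_id"
    using lower_unitriangular_right_inverse[OF A] by blast
  obtain C where C: "lower_unitriangular C" "smat_mult B C = smat_id"
    using lower_unitriangular_right_inverse[OF B(1)] by blast
  have "A = C"
    using smat_mult_assoc_lower[OF A B(1), of C] by (simp add: B(2) C(2) smat_id_left smat_id_right)
  with C have BA: "smat_mult B A = smat_id" by simp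
  have "smat_inv A = B"
    unfolding smat_inv_def
  proof (rule the_equality)
    fix D assume D: "smat_mult A D = smat_id \<and> smat_mult D A = smat_id"
    show "D = B"
      using smat_mult_assoc_lower[OF B(1) A, of D] D by (simp add: BA smat_id_left smat_id_right)
  qed (simp add: B BA)
  with B show "lower_unitriangular (smat_inv A)" "smat_mult A (smat_inv A) = smat_id" by simp_all
qed

lemma lower_unitriangular_inverse_sum:
  assumes A: "lower_unitriangular A"
  shows "(\<Sum>j\<le>n. A n j * smat_inv A j l) = (if n = l then 1 else 0)"
proof -
  have "(\<Sum>j\<le>n. A n j * smat_inv A j l) = smat_mult A (smat_inv A) n l"
    using A by (intro smat_mult_lower[symmetric]) (simp add: lower_unitriangular_def)
  then show ?thesis by (simp add: smat_inv_lower(2)[OF A] smat_id_def)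
qed

lemma smat_diag_transpose_mult:
  "smat_mult (smat_diag h) (smat_transpose B) n k = h n * B k n"
proof -
  have "smat_mult (smat_diag h) (smat_transpose B) n k = (\<Sum>l\<in>{n}. smat_diag h n l * smat_transpose B l k)"
    unfolding smat_mult_def by (rule suminf_finite) (auto simp: smat_diag_def)
  then show ?thesis by (simp add: smat_diag_def smat_transpose_def)
qed

text \<open>Both triangular factors cut the sum off: beyond \<open>i\<close> through \<open>smat_inv S1\<close>, beyond \<open>j\<close> through
  \<open>smat_inv S2\<close>. The free bound \<open>m\<close> allows a common range of summation for many entries.\<close>

lemma gauss_borel_entries:
  assumes G: "gauss_borel G S1 h S2" and m: "min i j \<le> m"
  shows "G i j = (\<Sum>l\<le>m. smat_inv S1 i l * h l * smat_inv S2 j l)"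
proof -
  let ?A = "smat_inv S1" and ?B = "smat_inv S2"
  have A0: "?A i l = 0" if "i < l" for i l
    using smat_inv_lower(1)[of S1] G that by (simp add: gauss_borel_def lower_unitriangular_def)
  have B0: "?B i l = 0" if "i < l" for i l
    using smat_inv_lower(1)[of S2] G that by (simp add: gauss_borel_def lower_unitriangular_def)
  have AD: "smat_mult ?A (smat_diag h) i l = ?A i l * h l" for l
  proof -
    have "smat_mult ?A (smat_diag h) i l = (\<Sum>k\<in>{l}. ?A i k * smat_diag h k l)"
      unfolding smat_mult_def by (rule suminf_finite) (auto simp: smat_diag_def)
    then show ?thesis by (simp add: smat_diag_def)
  qed
  have "G i j = smat_mult (smat_mult ?A (smat_diag h)) (smat_transpose ?B) i j"
    using G by (simp add: gauss_borel_def)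
  also have "\<dots> = (\<Sum>l\<le>m. smat_mult ?A (smat_diag h) i l * smat_transpose ?B l j)"
  proof (unfold smat_mult_def[of "smat_mult ?A (smat_diag h)"], rule suminf_finite)
    fix l assume "l \<notin> {..m}"
    with m have "i < l \<or> j < l" by auto
    then show "smat_mult ?A (smat_diag h) i l * smat_transpose ?B l j = 0"
      unfolding AD smat_transpose_def using A0 B0 by auto
  qed simp
  finally show ?thesis by (simp add: AD smat_transpose_def)
qed

text \<open>The identity of \<open>S1 G\<close> with \<open>H\<close> times the inverse transpose of \<open>S2\<close>, in entries: the sum over \<open>j\<close>
  contracts \<open>S1\<close> with its inverse. The column version is the same for the transposed factorization.\<close>

lemma gauss_borel_row:
  assumes G: "gauss_borel G S1 h S2"
  shows "(\<Sum>j\<le>n. S1 n j * G j k) = h n * smat_inv S2 k n"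
proof -
  have S1: "lower_unitriangular S1" using G by (simp add: gauss_borel_def)
  have "(\<Sum>j\<le>n. S1 n j * G j k) = (\<Sum>j\<le>n. \<Sum>l\<le>n. S1 n j * smat_inv S1 j l * (h l * smat_inv S2 k l))"
    by (intro sum.cong refl, subst gauss_borel_entries[OF G, of _ _ n])
       (auto simp: sum_distrib_left mult_ac)
  also have "\<dots> = (\<Sum>l\<le>n. (\<Sum>j\<le>n. S1 n j * smat_inv S1 j l) * (h l * smat_inv S2 k l))"
    by (subst sum.swap) (simp add: sum_distrib_right)
  also have "\<dots> = (\<Sum>l\<le>n. if n = l then h l * smat_inv S2 k l else 0)"
    by (intro sum.cong refl) (simp add: lower_unitriangular_inverse_sum[OF S1])
  finally show ?thesis by simp
qed

lemma gauss_borel_column: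
  assumes G: "gauss_borel G S1 h S2"
  shows "(\<Sum>j\<le>n. S2 n j * G k j) = h n * smat_inv S1 k n"
proof -
  have S2: "lower_unitriangular S2" using G by (simp add: gauss_borel_def)
  have "(\<Sum>j\<le>n. S2 n j * G k j) = (\<Sum>j\<le>n. \<Sum>l\<le>n. S2 n j * smat_inv S2 j l * (h l * smat_inv S1 k l))"
    by (intro sum.cong refl, subst gauss_borel_entries[OF G, of _ _ n])
       (auto simp: sum_distrib_left mult_ac)
  also have "\<dots> = (\<Sum>l\<le>n. (\<Sum>j\<le>n. S2 n j * smat_inv S2 j l) * (h l * smat_inv S1 k l))"
    by (subst sum.swap) (simp add: sum_distrib_right)
  also have "\<dots> = (\<Sum>l\<le>n. if n = l then h l * smat_inv S1 k l else 0)"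
    by (intro sum.cong refl) (simp add: lower_unitriangular_inverse_sum[OF S2])
  finally show ?thesis by simp
qed

lemma smat_vec_lower:
  assumes "lower_unitriangular A"
  shows "smat_vec A v n = (\<Sum>j\<le>n. A n j * v j)"
  unfolding smat_vec_def
  by (rule suminf_finite) (use assms in \<open>auto simp: lower_unitriangular_def\<close>)

lemma inner_axes [simp]: "inner p (1, 0) = fst p" "inner p (0, 1) = snd p"
  for p :: "real \<times> real"
  by (simp_all add: inner_prod_def)

lemma slow_funs_fst: "(\<lambda>p. complex_of_real (fst p)) \<in> slow_funs"
  using slow_funs_inner[of "(1, 0)"] by simp

lemma slow_funs_snd: "(\<lambda>p. complex_of_real (snd p)) \<in> slow_funs"
  using slow_funs_inner[of "(0, 1)"] by simp

lemmas slow_funs_intros =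
  slow_funs_sum slow_funs_mult slow_funs_power slow_funs_fst slow_funs_snd slow_funs_const

lemma gram_eq:
  assumes "generalized_kernel u"
  shows "gram u k l = u (\<lambda>p. complex_of_real (fst p) ^ k * complex_of_real (snd p) ^ l)"
  unfolding gram_def by (rule pairing_eq[OF assms, of _ UNIV]) (simp_all add: slow_funs_intros)

text \<open>A kernel with empty support is zero, while the first principal minor \<open>G\<^sub>0\<^sub>0 = u(1)\<close> of a
  quasi-definite kernel is not. This matters because the supremum over an empty support is \<open>-\<infinity>\<close>,
  which would admit \<open>z = 0\<close>.\<close>

lemma dist_support_nonempty:
  assumes u: "generalized_kernel u" and qd: "quasi_definite u"
  shows "dist_support u \<noteq> {}"
proof
  assume empty: "dist_support u = {}"
  have "Determinant.det (Matrix.mat 1 1 (\<lambda>(i, j). gram u i j)) \<noteq> 0"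
    using qd unfolding quasi_definite_def by blast
  then have "gram u 0 0 \<noteq> 0" by (subst (asm) det_single) auto
  moreover have "gram u 0 0 = 0"
    unfolding gram_eq[OF u] by (rule null_near_support[OF u, of _ "{}"]) (simp_all add: empty slow_funs_intros)
  ultimately show False by contradiction
qed

lemma support_radius:
  fixes S :: "real set"
  assumes "S \<noteq> {}" and less: "(SUP y\<in>S. ereal \<bar>y\<bar>) < ereal c"
  obtains r where "0 \<le> r" "r < c" "\<And>y. y \<in> S \<Longrightarrow> \<bar>y\<bar> \<le> r"
proof -
  obtain r where r: "(SUP y\<in>S. ereal \<bar>y\<bar>) < ereal r" "ereal r < ereal c"
    using ereal_dense2[OF less] by blast
  have le: "\<bar>y\<bar> \<le> r" if "y \<in> S" for y
    using le_less_trans[OF SUP_upper[OF that, of "\<lambda>y. ereal \<bar>y\<bar>"] r(1)] by simp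
  moreover have "0 \<le> r" using assms(1) le by fastforce
  ultimately show ?thesis using r(2) that by simp
qed

text \<open>The resolvent is expanded in the variable \<open>y\<close> with the polynomial in \<open>x\<close> as the slowly increasing
  factor; the coefficients are then finite combinations of moments.\<close>

lemma second_kind1_expansion:
  assumes u: "generalized_kernel u" and "dist_support u \<noteq> {}" and S1: "lower_unitriangular S1"
    and less: "(SUP y\<in>supp_y u. ereal \<bar>y\<bar>) < ereal (cmod z)"
  shows "(\<lambda>k. (\<Sum>j\<le>n. S1 n j * gram u j k) / z ^ Suc k) sums second_kind1 u S1 n z"
proof -
  have "supp_y u \<noteq> {}" using assms(2) by (simp add: supp_y_def)
  then obtain r where r: "0 \<le> r" "r < cmod z" "\<And>y. y \<in> supp_y u \<Longrightarrow> \<bar>y\<bar> \<le> r"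
    using support_radius[OF _ less] by blast
  have supp: "\<bar>inner p (0, 1)\<bar> \<le> r" if "p \<in> dist_support u" for p
    using r(3)[OF subsetD[OF closure_subset imageI[OF that], of snd, folded supp_y_def]] by simp
  define Q where "Q p = (\<Sum>j\<le>n. S1 n j * complex_of_real (fst p) ^ j)" for p :: "real \<times> real"
  have Q: "Q \<in> slow_funs" unfolding Q_def by (intro slow_funs_intros)
  have v: "(0, 1) \<in> (Basis :: (real \<times> real) set)" by (simp add: Basis_prod_def)
  obtain \<phi> U where \<phi>: "\<phi> \<in> slow_funs" "open U" "dist_support u \<subseteq> U"
    "\<And>p. p \<in> U \<Longrightarrow> \<phi> p = Q p / (z - complex_of_real (inner p (0, 1)))"
    "(\<lambda>k. u (\<lambda>p. Q p * complex_of_real (inner p (0, 1)) ^ k) / z ^ Suc k) sums u \<phi>"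
    using kernel_resolvent_expansion[OF u v Q r(1,2) supp] by blast
  have "second_kind1 u S1 n z = u \<phi>"
    unfolding second_kind1_def
    by (rule pairing_eq[OF u \<phi>(1-3)]) (simp add: \<phi>(4) Q_def smat_vec_lower[OF S1] chi_def)
  moreover have "u (\<lambda>p. Q p * complex_of_real (inner p (0, 1)) ^ k) = (\<Sum>j\<le>n. S1 n j * gram u j k)" for k
  proof -
    have "u (\<lambda>p. Q p * complex_of_real (inner p (0, 1)) ^ k) =
        u (\<lambda>p. \<Sum>j\<le>n. S1 n j * (complex_of_real (fst p) ^ j * complex_of_real (snd p) ^ k))"
      by (simp add: Q_def sum_distrib_left mult_ac)
    also have "\<dots> = (\<Sum>j\<le>n. u (\<lambda>p. S1 n j * (complex_of_real (fst p) ^ j * complex_of_real (snd p) ^ k)))"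
      by (intro kernel_sum[OF u] slow_funs_intros)
    also have "\<dots> = (\<Sum>j\<le>n. S1 n j * gram u j k)"
      unfolding gram_eq[OF u] by (intro sum.cong refl kernel_cmult[OF u] slow_funs_intros)
    finally show ?thesis .
  qed
  ultimately show ?thesis using \<phi>(5) by simp
qed

lemma second_kind2_expansion:
  assumes u: "generalized_kernel u" and "dist_support u \<noteq> {}" and S2: "lower_unitriangular S2"
    and less: "(SUP x\<in>supp_x u. ereal \<bar>x\<bar>) < ereal (cmod z)"
  shows "(\<lambda>k. (\<Sum>j\<le>n. S2 n j * gram u k j) / z ^ Suc k) sums second_kind2 u S2 n z"
proof -
  have "supp_x u \<noteq> {}" using assms(2) by (simp add: supp_x_def)
  then obtain r where r: "0 \<le> r" "r < cmod z" "\<And>x. x \<in> supp_x u \<Longrightarrow> \<bar>x\<bar> \<le> r"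
    using support_radius[OF _ less] by blast
  have supp: "\<bar>inner p (1, 0)\<bar> \<le> r" if "p \<in> dist_support u" for p
    using r(3)[OF subsetD[OF closure_subset imageI[OF that], of fst, folded supp_x_def]] by simp
  define Q where "Q p = (\<Sum>j\<le>n. S2 n j * complex_of_real (snd p) ^ j)" for p :: "real \<times> real"
  have Q: "Q \<in> slow_funs" unfolding Q_def by (intro slow_funs_intros)
  have v: "(1, 0) \<in> (Basis :: (real \<times> real) set)" by (simp add: Basis_prod_def)
  obtain \<phi> U where \<phi>: "\<phi> \<in> slow_funs" "open U" "dist_support u \<subseteq> U"
    "\<And>p. p \<in> U \<Longrightarrow> \<phi> p = Q p / (z - complex_of_real (inner p (1, 0)))"
    "(\<lambda>k. u (\<lambda>p. Q p * complex_of_real (inner p (1, 0)) ^ k) / z ^ Suc k) sums u \<phi>"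
    using kernel_resolvent_expansion[OF u v Q r(1,2) supp] by blast
  have "second_kind2 u S2 n z = u \<phi>"
    unfolding second_kind2_def
    by (rule pairing_eq[OF u \<phi>(1-3)]) (simp add: \<phi>(4) Q_def smat_vec_lower[OF S2] chi_def)
  moreover have "u (\<lambda>p. Q p * complex_of_real (inner p (1, 0)) ^ k) = (\<Sum>j\<le>n. S2 n j * gram u k j)" for k
  proof -
    have "u (\<lambda>p. Q p * complex_of_real (inner p (1, 0)) ^ k) =
        u (\<lambda>p. \<Sum>j\<le>n. S2 n j * (complex_of_real (fst p) ^ k * complex_of_real (snd p) ^ j))"
      by (simp add: Q_def sum_distrib_left mult_ac)
    also have "\<dots> = (\<Sum>j\<le>n. u (\<lambda>p. S2 n j * (complex_of_real (fst p) ^ k * complex_of_real (snd p) ^ j)))"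
      by (intro kernel_sum[OF u] slow_funs_intros)
    also have "\<dots> = (\<Sum>j\<le>n. S2 n j * gram u k j)"
      unfolding gram_eq[OF u] by (intro sum.cong refl kernel_cmult[OF u] slow_funs_intros)
    finally show ?thesis .
  qed
  ultimately show ?thesis using \<phi>(5) by simp
qed

theorem proposition8:
  fixes u :: "(real \<times> real \<Rightarrow> complex) \<Rightarrow> complex"
    and S1 S2 :: "nat \<Rightarrow> nat \<Rightarrow> complex"
    and h :: "nat \<Rightarrow> complex"
  assumes "generalized_kernel u"
    and "quasi_definite u"
    and "gauss_borel (gram u) S1 h S2"
  shows "(\<forall>z. (SUP y\<in>supp_y u. ereal \<bar>y\<bar>) < ereal (cmod z) \<longrightarrow>
            (\<forall>n. (\<lambda>k. smat_mult (smat_diag h) (smat_transpose (smat_inv S2)) n k * chi_star z k)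
                   sums second_kind1 u S1 n z)) \<and>
         (\<forall>z. (SUP x\<in>supp_x u. ereal \<bar>x\<bar>) < ereal (cmod z) \<longrightarrow>
            (\<forall>n. (\<lambda>k. smat_mult (smat_diag h) (smat_transpose (smat_inv S1)) n k * chi_star z k)
                   sums second_kind2 u S2 n z))"
proof -
  have S: "lower_unitriangular S1" "lower_unitriangular S2"
    using assms(3) by (simp_all add: gauss_borel_def)
  have ne: "dist_support u \<noteq> {}"
    using dist_support_nonempty[OF assms(1,2)] .
  show ?thesis
    using second_kind1_expansion[OF assms(1) ne S(1)] second_kind2_expansion[OF assms(1) ne S(2)]
    by (simp add: smat_diag_transpose_mult chi_star_def
        gauss_borel_row[OF assms(3)] gauss_borel_column[OF assms(3)])
qed

end
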